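(* Let $f\colon M^2\to(N^3,g)$ be a front with unit normal vector field $\nu$, and $\gamma(t)$ a singular curve consisting of cuspidal edges. The singular curvature $$\kappa_s(t)=\mathrm{sgn}\bigl(d\lambda(\eta)\bigr)\,\frac{\mu_g\bigl(\hat\gamma'(t),\hat\gamma''(t),\nu\bigr)}{|\hat\gamma'(t)|^3}$$ does not depend on the parameter $t$ of the singular curve, nor on the orientation of $M^2$, nor on the choice of $\nu$ (i.e. it is unchanged when $\nu$ is replaced by $-\nu$), nor on the orientation of the singular curve.
   Context: All objects are $C^\infty$. $M^2$ is an oriented $2$-manifold and $(N^3,g)$ an oriented Riemannian $3$-manifold with Levi-Civita connection $D$ and volume form $\mu_g$. A smooth map $f\colon M^2\to N^3$ is a front if there is a unit vector field $\nu$ of $N^3$ along $f$ (unit normal vector field) with $g(f_*X,\nu)=0$ for all $X\in TM^2$ and such that $(f,\nu)\colon M^2\to T_1N^3$ is an immersion. In local coordinates $(u,v)$ compatible with the orientation of $M^2$, $\lambda=\mu_g(f_u,f_v,\nu)$ is the signed area density function. Singular points are the points where $f$ is not an immersion. A cuspidal edge is a singular point at which $f$ is locally diffeomorphic (by diffeomorphism germs of source and target) to $(u,v)\mapsto(u^2,u^3,v)$ at $(0,0)$; near it the singular set is a regular curve (singular curve) $\gamma(t)$, $d\lambda\ne0$, and the kernel of $f_*$ is a line (null direction) transversal to $\gamma'$. In the formula, $\eta(t)$ is a vector field along $\gamma$ spanning the null direction (null vector field) such that $(\gamma'(t),\eta(t))$ is a positively oriented frame of $M^2$, $\hat\gamma=f\circ\gamma$,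 $\hat\gamma'=d\hat\gamma/dt$ and $\hat\gamma''=D_t\hat\gamma'$. *)

theory Defs
  imports "HOL-Analysis.Analysis"
begin

section \<open>Smooth manifolds\<close>

text \<open>
  For an open set \<open>U\<close> of a Euclidean space this is being \<open>k\<close> times continuously differentiable
  on \<open>U\<close>; the values of \<open>h\<close> outside \<open>U\<close> are irrelevant.
\<close>

primrec Ck_on :: "nat \<Rightarrow> 'a::euclidean_space set \<Rightarrow> ('a \<Rightarrow> 'b::euclidean_space) \<Rightarrow> bool"
  where
    "Ck_on 0 U h \<longleftrightarrow> continuous_on U h"
  | "Ck_on (Suc k) U h \<longleftrightarrow>
       (\<forall>x\<in>U. h differentiable (at x)) \<and> (\<forall>v. Ck_on k U (\<lambda>x. frechet_derivative h (at x) v))"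

definition smooth_on :: "'a::euclidean_space set \<Rightarrow> ('a \<Rightarrow> 'b::euclidean_space) \<Rightarrow> bool"
  where "smooth_on U h \<longleftrightarrow> (\<forall>k. Ck_on k U h)"

text \<open>
  A chart is a pair of its domain and its coordinate map; the values of the coordinate map
  outside the domain are irrelevant.
\<close>

type_synonym ('m, 'k) chart = "'m set \<times> ('m \<Rightarrow> real ^ 'k)"

abbreviation chart_dom :: "('m, 'k) chart \<Rightarrow> 'm set"
  where "chart_dom c \<equiv> fst c"

abbreviation coord :: "('m, 'k) chart \<Rightarrow> 'm \<Rightarrow> real ^ 'k"
  where "coord c \<equiv> snd c"

definition param :: "('m, 'k) chart \<Rightarrow> real ^ 'k \<Rightarrow> 'm"
  where "param c = inv_into (chart_dom c) (coord c)"

definition is_chart :: "('m::topological_space, 'k::finite) chart \<Rightarrow> bool"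
  where "is_chart c \<longleftrightarrow>
    open (chart_dom c) \<and> open (coord c ` chart_dom c) \<and>
    homeomorphism (chart_dom c) (coord c ` chart_dom c) (coord c) (param c)"

definition transition :: "('m, 'k) chart \<Rightarrow> ('m, 'k) chart \<Rightarrow> real ^ 'k \<Rightarrow> real ^ 'k"
  where "transition c d = (\<lambda>z. coord d (param c z))"

definition smoothly_compatible :: "('m, 'k::finite) chart \<Rightarrow> ('m, 'k) chart \<Rightarrow> bool"
  where "smoothly_compatible c d \<longleftrightarrow>
    smooth_on (coord c ` (chart_dom c \<inter> chart_dom d)) (transition c d) \<and>
    smooth_on (coord d ` (chart_dom c \<inter> chart_dom d)) (transition d c)"

text \<open>A smooth structure is a maximal smooth atlas, so its charts are all the local diffeomorphisms
  to Euclidean space.\<close>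

definition smooth_structure :: "('m::topological_space, 'k::finite) chart set \<Rightarrow> bool"
  where "smooth_structure A \<longleftrightarrow>
    (\<forall>c\<in>A. is_chart c) \<and>
    (\<Union>c\<in>A. chart_dom c) = UNIV \<and>
    (\<forall>c\<in>A. \<forall>d\<in>A. smoothly_compatible c d) \<and>
    (\<forall>c. is_chart c \<and> (\<forall>d\<in>A. smoothly_compatible c d) \<longrightarrow> c \<in> A)"

definition jac :: "('m, 'k::finite) chart \<Rightarrow> ('m, 'k) chart \<Rightarrow> 'm \<Rightarrow> real ^ 'k \<Rightarrow> real ^ 'k"
  where "jac c d p = frechet_derivative (transition c d) (at (coord c p))"

definition positively_compatible :: "('m, 'k::finite) chart \<Rightarrow> ('m, 'k) chart \<Rightarrow> bool"
  where "positively_compatible c d \<longleftrightarrow>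
    (\<forall>p \<in> chart_dom c \<inter> chart_dom d. det (matrix (jac c d p)) > 0)"

text \<open>An orientation of a manifold with smooth structure \<open>A\<close> is a maximal oriented subatlas of \<open>A\<close>;
  its members are the charts compatible with the orientation.\<close>

definition orientation :: "('m, 'k::finite) chart set \<Rightarrow> ('m, 'k) chart set \<Rightarrow> bool"
  where "orientation A Or \<longleftrightarrow>
    Or \<subseteq> A \<and>
    (\<Union>c\<in>Or. chart_dom c) = UNIV \<and>
    (\<forall>c\<in>Or. \<forall>d\<in>Or. positively_compatible c d) \<and>
    (\<forall>c\<in>A. (\<forall>d\<in>Or. positively_compatible c d) \<longrightarrow> c \<in> Or)"

definition chart_at :: "('m, 'k) chart set \<Rightarrow> 'm \<Rightarrow> ('m, 'k) chart"
  where "chart_at A p = (SOME c. c \<in> A \<and> p \<in> chart_dom c)"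

definition smooth_map ::
  "('m::topological_space, 'k::finite) chart set \<Rightarrow> ('n::topological_space, 'l::finite) chart set
   \<Rightarrow> ('m \<Rightarrow> 'n) \<Rightarrow> bool"
  where "smooth_map A B f \<longleftrightarrow>
    continuous_on UNIV f \<and>
    (\<forall>c\<in>A. \<forall>d\<in>B. smooth_on (coord c ` (chart_dom c \<inter> f -` chart_dom d))
                        (\<lambda>z. coord d (f (param c z))))"

section \<open>Tangent vectors\<close>

text \<open>
  A tangent vector at \<open>p\<close> is the family of its component vectors in all charts around \<open>p\<close>, which
  are related by the Jacobians of the coordinate changes. The entries at the charts not
  containing \<open>p\<close> are set to zero.
\<close>

type_synonym ('m, 'k) tvec = "('m, 'k) chart \<Rightarrow> real ^ 'k"

definition tangent_space :: "('m, 'k::finite) chart set \<Rightarrow> 'm \<Rightarrow> ('m, 'k) tvec set"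
  where "tangent_space A p = {X.
    (\<forall>c\<in>A. \<forall>d\<in>A. p \<in> chart_dom c \<inter> chart_dom d \<longrightarrow> X d = jac c d p (X c)) \<and>
    (\<forall>c. \<not> (c \<in> A \<and> p \<in> chart_dom c) \<longrightarrow> X c = 0)}"

text \<open>The tangent vector at \<open>p\<close> whose component vector in the chart \<open>c\<close> is \<open>x\<close>.\<close>

definition tangent_of ::
  "('m, 'k::finite) chart set \<Rightarrow> ('m, 'k) chart \<Rightarrow> 'm \<Rightarrow> real ^ 'k \<Rightarrow> ('m, 'k) tvec"
  where "tangent_of A c p x = (\<lambda>d. if d \<in> A \<and> p \<in> chart_dom d then jac c d p x else 0)"

definition pushforward ::
  "('m, 'k::finite) chart set \<Rightarrow> ('n, 'l::finite) chart set \<Rightarrow> ('m \<Rightarrow> 'n) \<Rightarrow> 'm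
   \<Rightarrow> ('m, 'k) tvec \<Rightarrow> ('n, 'l) tvec"
  where "pushforward A B f p X = (\<lambda>d. if d \<in> B \<and> f p \<in> chart_dom d
    then let c = chart_at A p
         in frechet_derivative (\<lambda>z. coord d (f (param c z))) (at (coord c p)) (X c)
    else 0)"

definition pos_frame :: "('m, 2) chart set \<Rightarrow> 'm \<Rightarrow> ('m, 2) tvec \<Rightarrow> ('m, 2) tvec \<Rightarrow> bool"
  where "pos_frame Or p X Y \<longleftrightarrow>
    (\<forall>c\<in>Or. p \<in> chart_dom c \<longrightarrow> det (vector [X c, Y c] :: real ^ 2 ^ 2) > 0)"

section \<open>Riemannian metric, volume form and Levi-Civita connection\<close>

definition metric_in ::
  "('n, 'k::finite) chart set \<Rightarrow> ('n \<Rightarrow> ('n, 'k) tvec \<Rightarrow> ('n, 'k) tvec \<Rightarrow> real)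
   \<Rightarrow> ('n, 'k) chart \<Rightarrow> 'n \<Rightarrow> real ^ 'k \<Rightarrow> real ^ 'k \<Rightarrow> real"
  where "metric_in A g c p x y = g p (tangent_of A c p x) (tangent_of A c p y)"

definition riemannian_metric ::
  "('n, 'k::finite) chart set \<Rightarrow> ('n \<Rightarrow> ('n, 'k) tvec \<Rightarrow> ('n, 'k) tvec \<Rightarrow> real) \<Rightarrow> bool"
  where "riemannian_metric A g \<longleftrightarrow>
    (\<forall>c\<in>A.
      (\<forall>p\<in>chart_dom c.
         bilinear (metric_in A g c p) \<and>
         (\<forall>x y. metric_in A g c p x y = metric_in A g c p y x) \<and>
         (\<forall>x. x \<noteq> 0 \<longrightarrow> metric_in A g c p x x > 0)) \<and>
      (\<forall>x y. smooth_on (coord c ` chart_dom c) (\<lambda>z. metric_in A g c (param c z) x y)))"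

text \<open>
  The form \<open>sqrt (det (g\<^sub>i\<^sub>j)) dx\<^sub>1 \<and> dx\<^sub>2 \<and> dx\<^sub>3\<close> in any positively oriented chart.
\<close>

definition volume_form ::
  "('n, 3) chart set \<Rightarrow> ('n, 3) chart set \<Rightarrow> ('n \<Rightarrow> ('n, 3) tvec \<Rightarrow> ('n, 3) tvec \<Rightarrow> real)
   \<Rightarrow> 'n \<Rightarrow> ('n, 3) tvec \<Rightarrow> ('n, 3) tvec \<Rightarrow> ('n, 3) tvec \<Rightarrow> real"
  where "volume_form A Or g p X Y Z =
    (let c = chart_at Or p in
      sqrt (det ((\<chi> i j. metric_in A g c p (axis i 1) (axis j 1)) :: real ^ 3 ^ 3)) *
      det (vector [X c, Y c, Z c] :: real ^ 3 ^ 3))"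

text \<open>
  An affine connection is given by its coefficients: \<open>\<Gamma> c p x y\<close> is the component vector in the
  chart \<open>c\<close> of the covariant derivative at \<open>p\<close>, in the direction with components \<open>x\<close>, of the vector
  field with constant components \<open>y\<close>. The last clause is the transformation law of connection
  coefficients: with \<open>\<phi>\<close> the coordinate change, the second derivative of \<open>\<phi>\<close> plus
  \<open>\<Gamma> d\<close> applied to \<open>D\<phi> x, D\<phi> y\<close> equals \<open>D\<phi>\<close> applied to \<open>\<Gamma> c x y\<close>.
\<close>

type_synonym ('n, 'k) conn = "('n, 'k) chart \<Rightarrow> 'n \<Rightarrow> real ^ 'k \<Rightarrow> real ^ 'k \<Rightarrow> real ^ 'k"

definition affine_connection :: "('n, 'k::finite) chart set \<Rightarrow> ('n, 'k) conn \<Rightarrow> bool"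
  where "affine_connection A \<Gamma> \<longleftrightarrow>
    (\<forall>c\<in>A. \<forall>p\<in>chart_dom c. bilinear (\<Gamma> c p)) \<and>
    (\<forall>c\<in>A. \<forall>x y. smooth_on (coord c ` chart_dom c) (\<lambda>z. \<Gamma> c (param c z) x y)) \<and>
    (\<forall>c\<in>A. \<forall>d\<in>A. \<forall>p \<in> chart_dom c \<inter> chart_dom d. \<forall>x y.
       jac c d p (\<Gamma> c p x y) =
         frechet_derivative (\<lambda>z. frechet_derivative (transition c d) (at z) y) (at (coord c p)) x
         + \<Gamma> d p (jac c d p x) (jac c d p y))"

text \<open>Coordinate fields commute, so vanishing torsion means symmetric coefficients; the last clause
  is \<open>Z (g(X,Y)) = g(D\<^sub>Z X, Y) + g(X, D\<^sub>Z Y)\<close> for fields with constant components.\<close>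

definition levi_civita ::
  "('n, 'k::finite) chart set \<Rightarrow> ('n \<Rightarrow> ('n, 'k) tvec \<Rightarrow> ('n, 'k) tvec \<Rightarrow> real)
   \<Rightarrow> ('n, 'k) conn \<Rightarrow> bool"
  where "levi_civita A g \<Gamma> \<longleftrightarrow>
    affine_connection A \<Gamma> \<and>
    (\<forall>c\<in>A. \<forall>p\<in>chart_dom c. \<forall>x y. \<Gamma> c p x y = \<Gamma> c p y x) \<and>
    (\<forall>c\<in>A. \<forall>p\<in>chart_dom c. \<forall>x y z.
       frechet_derivative (\<lambda>w. metric_in A g c (param c w) x y) (at (coord c p)) z =
         metric_in A g c p (\<Gamma> c p z x) y + metric_in A g c p x (\<Gamma> c p z y))"

section \<open>Curves\<close>

definition smooth_curve ::
  "('m::topological_space, 'k::finite) chart set \<Rightarrow> real set \<Rightarrow> (real \<Rightarrow> 'm) \<Rightarrow> bool"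
  where "smooth_curve A I \<gamma> \<longleftrightarrow>
    continuous_on I \<gamma> \<and>
    (\<forall>c\<in>A. smooth_on (I \<inter> \<gamma> -` chart_dom c) (\<lambda>t. coord c (\<gamma> t)))"

definition velocity :: "('m, 'k::finite) chart set \<Rightarrow> (real \<Rightarrow> 'm) \<Rightarrow> real \<Rightarrow> ('m, 'k) tvec"
  where "velocity A \<gamma> t = (\<lambda>c. if c \<in> A \<and> \<gamma> t \<in> chart_dom c
    then vector_derivative (\<lambda>s. coord c (\<gamma> s)) (at t) else 0)"

text \<open>The covariant derivative \<open>D\<^sub>t \<gamma>'\<close>.\<close>

definition acceleration ::
  "('n, 'k::finite) chart set \<Rightarrow> ('n, 'k) conn \<Rightarrow> (real \<Rightarrow> 'n) \<Rightarrow> real \<Rightarrow> ('n, 'k) tvec"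
  where "acceleration A \<Gamma> \<gamma> t = (\<lambda>c. if c \<in> A \<and> \<gamma> t \<in> chart_dom c
    then vector_derivative (\<lambda>s. vector_derivative (\<lambda>r. coord c (\<gamma> r)) (at s)) (at t)
         + \<Gamma> c (\<gamma> t) (velocity A \<gamma> t c) (velocity A \<gamma> t c)
    else 0)"

definition reparametrization :: "real set \<Rightarrow> real set \<Rightarrow> (real \<Rightarrow> real) \<Rightarrow> bool"
  where "reparametrization J I s \<longleftrightarrow>
    bij_betw s J I \<and> smooth_on J s \<and> smooth_on I (inv_into J s)"

section \<open>Fronts and their singular curvature\<close>

definition unit_normal_field ::
  "('m::topological_space, 2) chart set \<Rightarrow> ('n::topological_space, 3) chart set
   \<Rightarrow> ('n \<Rightarrow> ('n, 3) tvec \<Rightarrow> ('n, 3) tvec \<Rightarrow> real)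
   \<Rightarrow> ('m \<Rightarrow> 'n) \<Rightarrow> ('m \<Rightarrow> ('n, 3) tvec) \<Rightarrow> bool"
  where "unit_normal_field AM AN g f \<nu> \<longleftrightarrow>
    (\<forall>p. \<nu> p \<in> tangent_space AN (f p) \<and> g (f p) (\<nu> p) (\<nu> p) = 1 \<and>
         (\<forall>X\<in>tangent_space AM p. g (f p) (pushforward AM AN f p X) (\<nu> p) = 0)) \<and>
    (\<forall>c\<in>AM. \<forall>d\<in>AN. smooth_on (coord c ` (chart_dom c \<inter> f -` chart_dom d))
                          (\<lambda>z. \<nu> (param c z) d))"

text \<open>
  The unit tangent bundle is an embedded submanifold of the tangent bundle of \<open>N\<close>, so the map
  \<open>(f, \<nu>)\<close> is an immersion into it iff it is one into the tangent bundle. The latter is tested in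
  the bundle charts \<open>(q, w) \<mapsto> (coord d q, w d)\<close>.
\<close>

definition immersive_lift ::
  "('m, 2) chart set \<Rightarrow> ('n, 3) chart set \<Rightarrow> ('m \<Rightarrow> 'n) \<Rightarrow> ('m \<Rightarrow> ('n, 3) tvec) \<Rightarrow> bool"
  where "immersive_lift AM AN f \<nu> \<longleftrightarrow>
    (\<forall>p. \<forall>c\<in>AM. \<forall>d\<in>AN. p \<in> chart_dom c \<and> f p \<in> chart_dom d \<longrightarrow>
       inj (frechet_derivative (\<lambda>z. (coord d (f (param c z)), \<nu> (param c z) d)) (at (coord c p))))"

definition front ::
  "('m::topological_space, 2) chart set \<Rightarrow> ('n::topological_space, 3) chart set
   \<Rightarrow> ('n \<Rightarrow> ('n, 3) tvec \<Rightarrow> ('n, 3) tvec \<Rightarrow> real)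
   \<Rightarrow> ('m \<Rightarrow> 'n) \<Rightarrow> ('m \<Rightarrow> ('n, 3) tvec) \<Rightarrow> bool"
  where "front AM AN g f \<nu> \<longleftrightarrow>
    smooth_map AM AN f \<and> unit_normal_field AM AN g f \<nu> \<and> immersive_lift AM AN f \<nu>"

definition singular_point ::
  "('m, 2) chart set \<Rightarrow> ('n, 3) chart set \<Rightarrow> ('m \<Rightarrow> 'n) \<Rightarrow> 'm \<Rightarrow> bool"
  where "singular_point AM AN f p \<longleftrightarrow> \<not> inj_on (pushforward AM AN f p) (tangent_space AM p)"

text \<open>The diffeomorphism germs of source and target bringing \<open>f\<close> into the normal form are charts.\<close>

definition cuspidal_edge ::
  "('m, 2) chart set \<Rightarrow> ('n, 3) chart set \<Rightarrow> ('m \<Rightarrow> 'n) \<Rightarrow> 'm \<Rightarrow> bool"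
  where "cuspidal_edge AM AN f p \<longleftrightarrow>
    singular_point AM AN f p \<and>
    (\<exists>c\<in>AM. \<exists>d\<in>AN. p \<in> chart_dom c \<and> f ` chart_dom c \<subseteq> chart_dom d \<and> coord c p = 0 \<and>
       (\<forall>q\<in>chart_dom c. coord d (f q) =
          vector [(coord c q $ 1)\<^sup>2, (coord c q $ 1) ^ 3, coord c q $ 2]))"

text \<open>A regular curve all of whose points are cuspidal edges.\<close>

definition cuspidal_edge_curve ::
  "('m::topological_space, 2) chart set \<Rightarrow> ('n, 3) chart set \<Rightarrow> ('m \<Rightarrow> 'n)
   \<Rightarrow> real set \<Rightarrow> (real \<Rightarrow> 'm) \<Rightarrow> bool"
  where "cuspidal_edge_curve AM AN f I \<gamma> \<longleftrightarrow>
    smooth_curve AM I \<gamma> \<and>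
    (\<forall>t\<in>I. velocity AM \<gamma> t \<noteq> (\<lambda>_. 0) \<and> cuspidal_edge AM AN f (\<gamma> t))"

definition null_field ::
  "('m::topological_space, 2) chart set \<Rightarrow> ('m, 2) chart set \<Rightarrow> ('n, 3) chart set \<Rightarrow> ('m \<Rightarrow> 'n)
   \<Rightarrow> real set \<Rightarrow> (real \<Rightarrow> 'm) \<Rightarrow> (real \<Rightarrow> ('m, 2) tvec) \<Rightarrow> bool"
  where "null_field AM OM AN f I \<gamma> \<eta> \<longleftrightarrow>
    (\<forall>c\<in>AM. smooth_on (I \<inter> \<gamma> -` chart_dom c) (\<lambda>t. \<eta> t c)) \<and>
    (\<forall>t\<in>I. {X \<in> tangent_space AM (\<gamma> t). pushforward AM AN f (\<gamma> t) X = (\<lambda>_. 0)}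
              = {(\<lambda>c. a *\<^sub>R \<eta> t c) | a. True} \<and>
            pos_frame OM (\<gamma> t) (velocity AM \<gamma> t) (\<eta> t))"

text \<open>The signed area density function in the coordinates \<open>c\<close>.\<close>

definition area_density ::
  "('m, 2) chart set \<Rightarrow> ('n, 3) chart set \<Rightarrow> ('n, 3) chart set
   \<Rightarrow> ('n \<Rightarrow> ('n, 3) tvec \<Rightarrow> ('n, 3) tvec \<Rightarrow> real)
   \<Rightarrow> ('m \<Rightarrow> 'n) \<Rightarrow> ('m \<Rightarrow> ('n, 3) tvec) \<Rightarrow> ('m, 2) chart \<Rightarrow> 'm \<Rightarrow> real"
  where "area_density AM AN ON g f \<nu> c q =
    volume_form AN ON g (f q)
      (pushforward AM AN f q (tangent_of AM c q (axis 1 1)))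
      (pushforward AM AN f q (tangent_of AM c q (axis 2 1)))
      (\<nu> q)"

text \<open>
  The singular curvature at \<open>t\<close>, computed with the null field \<open>\<eta>\<close> and with the signed area density
  in the coordinates \<open>c\<close> around \<open>\<gamma> t\<close>. The orientation of \<open>M\<close> enters through \<open>c\<close> and \<open>\<eta>\<close>.
\<close>

definition singular_curvature ::
  "('m, 2) chart set \<Rightarrow> ('n, 3) chart set \<Rightarrow> ('n, 3) chart set
   \<Rightarrow> ('n \<Rightarrow> ('n, 3) tvec \<Rightarrow> ('n, 3) tvec \<Rightarrow> real) \<Rightarrow> ('n, 3) conn
   \<Rightarrow> ('m \<Rightarrow> 'n) \<Rightarrow> ('m \<Rightarrow> ('n, 3) tvec) \<Rightarrow> ('m, 2) chart
   \<Rightarrow> (real \<Rightarrow> 'm) \<Rightarrow> (real \<Rightarrow> ('m, 2) tvec) \<Rightarrow> real \<Rightarrow> real"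
  where "singular_curvature AM AN ON g \<Gamma> f \<nu> c \<gamma> \<eta> t =
    (let \<gamma>h = (\<lambda>s. f (\<gamma> s)); p = \<gamma> t;
         dL = frechet_derivative (\<lambda>z. area_density AM AN ON g f \<nu> c (param c z)) (at (coord c p))
     in sgn (dL (\<eta> t c)) *
        (volume_form AN ON g (f p) (velocity AN \<gamma>h t) (acceleration AN \<Gamma> \<gamma>h t) (\<nu> p)
         / sqrt (g (f p) (velocity AN \<gamma>h t) (velocity AN \<gamma>h t)) ^ 3))"

end

theory Submission
  imports Defs
begin

text \<open>
  Let \<open>D\<close> be the Jacobian determinant of the coordinate change from \<open>c'\<close> to \<open>c\<close> at the given point, and
  \<open>s'\<close>, \<open>a\<close>, \<open>k\<close> the factors by which \<open>\<gamma>'\<close>, \<open>\<eta>\<close> and \<open>\<nu>\<close> change. The new area density is \<open>k\<close> times the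
  Jacobian determinant times the old one, and as both vanish at the point, the product rule shows
  that \<open>d\<lambda>(\<eta>)\<close> is multiplied by \<open>k D a\<close>. Since both frames \<open>(\<gamma>', \<eta>)\<close> are positive, \<open>D\<close> has the sign
  of \<open>s' a\<close>. The new acceleration of the image curve is \<open>s'\<^sup>2\<close> times the old one plus a multiple of
  the velocity, so the quotient in the singular curvature is multiplied by \<open>k s'\<^sup>3 / |s'|\<^sup>3\<close>, and all
  signs cancel.
\<close>

section \<open>Smooth functions on Euclidean spaces\<close>

lemma smooth_on_subset:
  assumes "smooth_on U h" "T \<subseteq> U"
  shows "smooth_on T h"
proof -
  have "Ck_on k T h" if "Ck_on k U h" for k
    using that assms(2) by (induction k arbitrary: h) (auto intro: continuous_on_subset)
  with assms(1) show ?thesis unfolding smooth_on_def by blast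
qed

lemma smooth_on_differentiable:
  assumes "smooth_on U h" "x \<in> U"
  shows "h differentiable (at x)"
proof -
  have "Ck_on (Suc 0) U h"
    using assms(1) unfolding smooth_on_def by blast
  with assms(2) show ?thesis by simp
qed

lemma smooth_on_frechet_derivative:
  assumes "smooth_on U h"
  shows "smooth_on U (\<lambda>x. frechet_derivative h (at x) v)"
  unfolding smooth_on_def
proof
  fix k
  have "Ck_on (Suc k) U h"
    using assms unfolding smooth_on_def by blast
  then show "Ck_on k U (\<lambda>x. frechet_derivative h (at x) v)" by simp
qed

section \<open>Derivatives of curves and the second-order chain rule\<close>

lemma vector_derivative_eq_frechet_derivative:
  fixes h :: "real \<Rightarrow> 'a::real_normed_vector"
  assumes "h differentiable (at x)"
  shows "vector_derivative h (at x) = frechet_derivative h (at x) 1"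
proof -
  have *: "(h has_derivative frechet_derivative h (at x)) (at x)"
    using assms frechet_derivative_works by blast
  then have "frechet_derivative h (at x) y = y *\<^sub>R frechet_derivative h (at x) 1" for y
    using linear_scale[OF has_derivative_linear[OF *], of y 1] by simp
  then have "frechet_derivative h (at x) = (\<lambda>y. y *\<^sub>R frechet_derivative h (at x) 1)" by blast
  with * have "(h has_vector_derivative frechet_derivative h (at x) 1) (at x)"
    unfolding has_vector_derivative_def by simp
  then show ?thesis by (rule vector_derivative_at)
qed

lemma differentiable_transform_open:
  assumes "h differentiable (at x)" "open S" "x \<in> S" "\<And>y. y \<in> S \<Longrightarrow> h y = k y"
  shows "k differentiable (at x)"
  using assms has_derivative_transform_within_open[of h _ x UNIV S k]
  unfolding differentiable_def by blast

text \<open>\<open>smooth_on\<close> speaks of Frechet derivatives in fixed directions; for a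
  function of a real variable the direction 1 gives the vector derivative.\<close>

lemma smooth_on_vector_derivative:
  assumes "smooth_on U h" "open U" "x \<in> U"
  shows "(\<lambda>t. vector_derivative h (at t)) differentiable (at x)"
proof (rule differentiable_transform_open)
  show "(\<lambda>t. frechet_derivative h (at t) 1) differentiable (at x)"
    using smooth_on_differentiable[OF smooth_on_frechet_derivative[OF assms(1)] assms(3)] .
  show "frechet_derivative h (at y) 1 = vector_derivative h (at y)" if "y \<in> U" for y
    using vector_derivative_eq_frechet_derivative smooth_on_differentiable assms(1) that by metis
qed (use assms in auto)

lemma vector_derivative_compose:
  fixes w :: "real \<Rightarrow> 'a::real_normed_vector"
  assumes "s differentiable (at t)" "w differentiable (at (s t))"
  shows "((\<lambda>r. w (s r)) has_vector_derivative
    vector_derivative s (at t) *\<^sub>R vector_derivative w (at (s t))) (at t)"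
  using vector_diff_chain_at[of s _ t w] assms
  by (simp add: vector_derivative_works o_def)

text \<open>Product rule for \<open>s'\<close> times \<open>w' o s\<close>. The summand along
  \<open>w'\<close> is the source of the tangential term in the acceleration of a reparametrized
  curve.\<close>

lemma vector_derivative_twice_compose:
  fixes w :: "real \<Rightarrow> 'a::real_normed_vector"
  assumes J: "open J" "t \<in> J"
    and s: "\<And>r. r \<in> J \<Longrightarrow> s differentiable (at r)"
    and w: "\<And>r. r \<in> J \<Longrightarrow> w differentiable (at (s r))"
    and s2: "(\<lambda>r. vector_derivative s (at r)) differentiable (at t)"
    and w2: "(\<lambda>r. vector_derivative w (at r)) differentiable (at (s t))"
  shows "vector_derivative (\<lambda>r. vector_derivative (\<lambda>q. w (s q)) (at r)) (at t) =
    (vector_derivative s (at t))\<^sup>2 *\<^sub>R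
      vector_derivative (\<lambda>r. vector_derivative w (at r)) (at (s t)) +
    vector_derivative (\<lambda>r. vector_derivative s (at r)) (at t) *\<^sub>R vector_derivative w (at (s t))"
proof (rule vector_derivative_at)
  have eq: "vector_derivative (\<lambda>q. w (s q)) (at r) =
      vector_derivative s (at r) *\<^sub>R vector_derivative w (at (s r))" if "r \<in> J" for r
    using vector_derivative_compose[OF s[OF that] w[OF that]] by (rule vector_derivative_at)
  have "((\<lambda>r. vector_derivative s (at r) *\<^sub>R vector_derivative w (at (s r))) has_vector_derivative
      vector_derivative s (at t) *\<^sub>R (vector_derivative s (at t) *\<^sub>R
        vector_derivative (\<lambda>r. vector_derivative w (at r)) (at (s t))) +
      vector_derivative (\<lambda>r. vector_derivative s (at r)) (at t) *\<^sub>R vector_derivative w (at (s t)))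
      (at t)"
    using s2 vector_derivative_compose[OF s[OF J(2)] w2]
    by (intro has_vector_derivative_scaleR)
      (auto simp: vector_derivative_works has_real_derivative_iff_has_vector_derivative)
  then show "((\<lambda>r. vector_derivative (\<lambda>q. w (s q)) (at r)) has_vector_derivative
      (vector_derivative s (at t))\<^sup>2 *\<^sub>R
        vector_derivative (\<lambda>r. vector_derivative w (at r)) (at (s t)) +
      vector_derivative (\<lambda>r. vector_derivative s (at r)) (at t) *\<^sub>R vector_derivative w (at (s t)))
      (at t)"
    using J eq
    by (subst has_vector_derivative_cong_ev[where
          g = "\<lambda>r. vector_derivative s (at r) *\<^sub>R vector_derivative w (at (s r))"])
      (auto simp: power2_eq_square elim!: eventually_mono[OF eventually_nhds_in_open])
qed

lemma linear_eq_sum_axis: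
  fixes L :: "real ^ 'k \<Rightarrow> 'b::real_vector"
  assumes "linear L"
  shows "L x = (\<Sum>i\<in>UNIV. x $ i *\<^sub>R L (axis i 1))"
proof -
  have "x = (\<Sum>i\<in>UNIV. x $ i *\<^sub>R axis i 1)"
    using basis_expansion[of x] by (simp add: scalar_mult_eq_scaleR)
  then have "L x = L (\<Sum>i\<in>UNIV. x $ i *\<^sub>R axis i 1)" by simp
  also have "\<dots> = (\<Sum>i\<in>UNIV. x $ i *\<^sub>R L (axis i 1))"
    using assms by (simp add: linear_sum linear_scale)
  finally show ?thesis .
qed

lemma differentiable_vec_nth:
  assumes "h differentiable (at x)"
  shows "(\<lambda>z. h z $ i) differentiable (at x)"
  using assms bounded_linear.has_derivative[OF bounded_linear_vec_nth]
  unfolding differentiable_def by blast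

text \<open>\<open>smooth_on\<close> controls the derivative of \<open>F\<close> in a fixed
  direction, whereas the direction \<open>u'\<close> in the chain rule varies with time. Expanding
  \<open>u'\<close> in the standard basis leaves a sum of products of differentiable
  functions.\<close>

lemma smooth_compose_curve_derivative_differentiable:
  fixes F :: "real ^ 'k \<Rightarrow> 'b::euclidean_space" and u :: "real \<Rightarrow> real ^ 'k"
  assumes F: "smooth_on U F" and u: "smooth_on I u" and I: "open I" "u ` I \<subseteq> U" and t: "t \<in> I"
  shows "(\<lambda>r. F (u r)) differentiable (at t)"
    and "(\<lambda>r. vector_derivative (\<lambda>q. F (u q)) (at r)) differentiable (at t)"
proof -
  have F': "(F has_derivative frechet_derivative F (at (u r))) (at (u r))" if "r \<in> I" for r
    using smooth_on_differentiable[OF F] I that frechet_derivative_works by blast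
  have u': "(u has_vector_derivative vector_derivative u (at r)) (at r)" if "r \<in> I" for r
    using smooth_on_differentiable[OF u that] by (simp add: vector_derivative_works)
  have comp: "((\<lambda>r. F (u r)) has_vector_derivative
      frechet_derivative F (at (u r)) (vector_derivative u (at r))) (at r)" if "r \<in> I" for r
    using vector_derivative_diff_chain_within[OF u'[OF that], of F] F'[OF that]
    by (simp add: o_def has_derivative_at_withinI)
  show "(\<lambda>r. F (u r)) differentiable (at t)"
    using comp[OF t] unfolding has_vector_derivative_def differentiable_def by blast
  have eq: "(\<Sum>i\<in>UNIV. vector_derivative u (at r) $ i *\<^sub>R frechet_derivative F (at (u r)) (axis i 1))
      = vector_derivative (\<lambda>q. F (u q)) (at r)" if "r \<in> I" for r
  proof -
    have "linear (frechet_derivative F (at (u r)))"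
      using F'[OF that] by (rule has_derivative_linear)
    from linear_eq_sum_axis[OF this, of "vector_derivative u (at r)"]
      vector_derivative_at[OF comp[OF that]] show ?thesis by simp
  qed
  have du: "u differentiable (at t)"
    using smooth_on_differentiable[OF u t] .
  note nth = differentiable_vec_nth[OF smooth_on_vector_derivative[OF u I(1) t]]
  have part: "(\<lambda>r. frechet_derivative F (at (u r)) v) differentiable (at t)" for v
    using differentiable_chain_at[OF du, of "\<lambda>x. frechet_derivative F (at x) v"]
      smooth_on_differentiable[OF smooth_on_frechet_derivative[OF F]] I(2) t
    by (auto simp: o_def)
  have "(\<lambda>r. \<Sum>i\<in>UNIV. vector_derivative u (at r) $ i *\<^sub>R frechet_derivative F (at (u r)) (axis i 1))
      differentiable (at t)"
    by (intro differentiable_sum differentiable_scaleR nth part ballI) auto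
  then show "(\<lambda>r. vector_derivative (\<lambda>q. F (u q)) (at r)) differentiable (at t)"
    using I(1) t eq by (rule differentiable_transform_open)
qed

section \<open>Charts and tangent vectors\<close>

text \<open>\<open>coord c\<close> is a homeomorphism onto an open set. Open images matter because a
  derivative in a chart may be computed from any function that agrees nearby.\<close>

lemma
  assumes "smooth_structure A" "c \<in> A"
  shows open_chart_dom: "open (chart_dom c)"
    and open_coord_image: "\<And>S. open S \<Longrightarrow> open (coord c ` (chart_dom c \<inter> S))"
    and param_coord: "\<And>p. p \<in> chart_dom c \<Longrightarrow> param c (coord c p) = p"
proof -
  have ch: "is_chart c"
    using assms unfolding smooth_structure_def by blast
  then have hom: "homeomorphism (chart_dom c) (coord c ` chart_dom c) (coord c) (param c)"
    and op: "open (chart_dom c)" "open (coord c ` chart_dom c)"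
    unfolding is_chart_def by auto
  show "open (chart_dom c)" by fact
  show "open (coord c ` (chart_dom c \<inter> S))" if "open S" for S
  proof -
    have "openin (top_of_set (coord c ` chart_dom c)) (coord c ` (chart_dom c \<inter> S))"
      using homeomorphism_imp_open_map[OF hom] that by (simp add: openin_open_Int)
    then show ?thesis using op openin_open_trans by blast
  qed
  show "param c (coord c p) = p" if "p \<in> chart_dom c" for p
    using hom that unfolding homeomorphism_def by blast
qed

text \<open>\<open>frechet_derivative\<close> is a choice operator; compatibility of the charts
  makes the coordinate change differentiable, so that the choice is its actual derivative.\<close>

lemma has_derivative_jac:
  assumes "smooth_structure A" "c \<in> A" "d \<in> A" "p \<in> chart_dom c" "p \<in> chart_dom d"
  shows "(transition c d has_derivative jac c d p) (at (coord c p))"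
proof -
  have "smooth_on (coord c ` (chart_dom c \<inter> chart_dom d)) (transition c d)"
    using assms(1-3) unfolding smooth_structure_def smoothly_compatible_def by blast
  then have "transition c d differentiable (at (coord c p))"
    using assms by (intro smooth_on_differentiable) auto
  then show ?thesis unfolding jac_def by (simp add: frechet_derivative_works)
qed

lemma linear_jac:
  assumes "smooth_structure A" "c \<in> A" "d \<in> A" "p \<in> chart_dom c" "p \<in> chart_dom d"
  shows "linear (jac c d p)"
  using has_derivative_jac[OF assms] by (rule has_derivative_linear)

text \<open>Chain rule for \<open>h o param d\<close> after the coordinate change; the composite
  equals \<open>h o param c\<close> only on the overlap of the charts. Later \<open>h\<close> is a
  coordinate map, a map read in a target chart, or the area density.\<close>

lemma has_derivative_change_chart:
  assumes A: "smooth_structure A" "c \<in> A" "d \<in> A" "p \<in> chart_dom c" "p \<in> chart_dom d"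
    and h: "((\<lambda>z. h (param d z)) has_derivative D) (at (coord d p))"
  shows "((\<lambda>z. h (param c z)) has_derivative (\<lambda>x. D (jac c d p x))) (at (coord c p))"
proof -
  have "((\<lambda>z. h (param d z)) has_derivative D) (at (transition c d (coord c p)))"
    using h A by (simp add: transition_def param_coord)
  from diff_chain_at[OF has_derivative_jac[OF A] this]
  have "((\<lambda>z. h (param d (transition c d z))) has_derivative (\<lambda>x. D (jac c d p x)))
      (at (coord c p))" by (simp add: o_def)
  then show ?thesis
  proof (rule has_derivative_transform_within_open)
    show "open (coord c ` (chart_dom c \<inter> chart_dom d))"
      using A by (simp add: open_coord_image open_chart_dom)
    show "h (param d (transition c d z)) = h (param c z)"
      if "z \<in> coord c ` (chart_dom c \<inter> chart_dom d)" for z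
      using that A by (auto simp: transition_def param_coord)
  qed (use A in auto)
qed

text \<open>The cocycle law of the Jacobians: the change of chart applied to \<open>coord e\<close>,
  and uniqueness of derivatives.\<close>

lemma jac_jac:
  assumes "smooth_structure A" "c \<in> A" "d \<in> A" "e \<in> A"
    "p \<in> chart_dom c" "p \<in> chart_dom d" "p \<in> chart_dom e"
  shows "jac d e p (jac c d p x) = jac c e p x"
proof -
  have "((\<lambda>z. coord e (param d z)) has_derivative jac d e p) (at (coord d p))"
    using has_derivative_jac[of A d e p] assms by (simp add: transition_def)
  from has_derivative_change_chart[OF assms(1-3,5,6) this]
  have "(transition c e has_derivative (\<lambda>x. jac d e p (jac c d p x))) (at (coord c p))"
    by (simp add: transition_def)
  with has_derivative_jac[of A c e p] assms have "(\<lambda>x. jac d e p (jac c d p x)) = jac c e p"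
    by (metis has_derivative_unique)
  then show ?thesis by metis
qed

lemma jac_self:
  assumes "smooth_structure A" "c \<in> A" "p \<in> chart_dom c"
  shows "jac c c p x = x"
proof -
  have "((\<lambda>z. z) has_derivative (\<lambda>x. x)) (at (coord c p))" by simp
  then have "(transition c c has_derivative (\<lambda>x. x)) (at (coord c p))"
  proof (rule has_derivative_transform_within_open)
    show "open (coord c ` (chart_dom c \<inter> UNIV))"
      using assms open_coord_image by blast
  qed (use assms in \<open>auto simp: transition_def param_coord\<close>)
  with has_derivative_jac[of A c c p] assms have "(\<lambda>x. x) = jac c c p"
    by (metis has_derivative_unique)
  then show ?thesis by metis
qed

section \<open>Tangent vectors and their components\<close>

lemma tangent_space_jac:
  assumes "X \<in> tangent_space A p" "c \<in> A" "d \<in> A" "p \<in> chart_dom c" "p \<in> chart_dom d"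
  shows "X d = jac c d p (X c)"
  using assms unfolding tangent_space_def by blast

lemma tangent_spaceI:
  assumes "\<And>c d. c \<in> A \<Longrightarrow> d \<in> A \<Longrightarrow> p \<in> chart_dom c \<Longrightarrow> p \<in> chart_dom d \<Longrightarrow> X d = jac c d p (X c)"
    and "\<And>c. \<not> (c \<in> A \<and> p \<in> chart_dom c) \<Longrightarrow> X c = 0"
  shows "X \<in> tangent_space A p"
  using assms unfolding tangent_space_def by blast

text \<open>The Jacobians carry one component to all charts around \<open>p\<close>; at the
  remaining charts both families are zero, which makes them equal as functions.\<close>

lemma tangent_space_eqI:
  assumes "X \<in> tangent_space A p" "Y \<in> tangent_space A p" "c \<in> A" "p \<in> chart_dom c" "X c = Y c"
  shows "X = Y"
proof
  fix d
  show "X d = Y d"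
  proof (cases "d \<in> A \<and> p \<in> chart_dom d")
    case True
    with assms show ?thesis by (metis tangent_space_jac)
  next
    case False
    have "Z d = 0" if "Z \<in> tangent_space A p" for Z
      using that False unfolding tangent_space_def by blast
    with assms show ?thesis by metis
  qed
qed

lemma tangent_of_in_tangent_space:
  assumes "smooth_structure A" "c \<in> A" "p \<in> chart_dom c"
  shows "tangent_of A c p x \<in> tangent_space A p"
  using assms by (auto simp: tangent_space_def tangent_of_def jac_jac)

lemma tangent_of_eq:
  assumes "smooth_structure A" "c \<in> A" "p \<in> chart_dom c" "X \<in> tangent_space A p"
  shows "tangent_of A c p (X c) = X"
  using assms by (intro tangent_space_eqI[OF tangent_of_in_tangent_space])
    (auto simp: tangent_of_def jac_self)

lemma tangent_of_change_chart:
  assumes "smooth_structure A" "c \<in> A" "d \<in> A" "p \<in> chart_dom c" "p \<in> chart_dom d"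
  shows "tangent_of A c p x = tangent_of A d p (jac c d p x)"
  using assms by (auto simp: tangent_of_def jac_jac)

lemma metric_in_change_chart:
  assumes "smooth_structure A" "c \<in> A" "d \<in> A" "p \<in> chart_dom c" "p \<in> chart_dom d"
  shows "metric_in A g c p x y = metric_in A g d p (jac c d p x) (jac c d p y)"
  using tangent_of_change_chart[OF assms] by (simp add: metric_in_def)

text \<open>Stated for any set of charts, since \<open>chart_at\<close> picks from the whole smooth
  structure in \<open>pushforward\<close> but from an orientation in
  \<open>volume_form\<close>.\<close>

lemma
  assumes "c \<in> B" "p \<in> chart_dom c"
  shows chart_at_mem: "chart_at B p \<in> B" and chart_at_dom: "p \<in> chart_dom (chart_at B p)"
proof -
  have "\<exists>c. c \<in> B \<and> p \<in> chart_dom c" using assms by blast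
  from someI_ex[OF this] show "chart_at B p \<in> B" "p \<in> chart_dom (chart_at B p)"
    unfolding chart_at_def by blast+
qed

lemma smooth_structure_chart_at:
  assumes "smooth_structure A"
  shows "chart_at A p \<in> A" "p \<in> chart_dom (chart_at A p)"
proof -
  obtain c where "c \<in> A" "p \<in> chart_dom c"
    using assms unfolding smooth_structure_def by blast
  then show "chart_at A p \<in> A" "p \<in> chart_dom (chart_at A p)"
    by (rule chart_at_mem, rule chart_at_dom)
qed

section \<open>The differential of a smooth map and velocities of curves\<close>

lemma smooth_map_differentiable:
  assumes "smooth_map A B f" "c \<in> A" "p \<in> chart_dom c" "d \<in> B" "f p \<in> chart_dom d"
  shows "(\<lambda>z. coord d (f (param c z))) differentiable (at (coord c p))"
  using assms smooth_on_differentiable unfolding smooth_map_def by blast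

text \<open>By the chain rule the arbitrary source chart \<open>chart_at A p\<close> inside
  \<open>pushforward\<close> can be exchanged for any chart \<open>c\<close> around
  \<open>p\<close>.\<close>

lemma pushforward_tangent_of:
  fixes A :: "('m::topological_space, 'k::finite) chart set"
    and B :: "('n::topological_space, 'l::finite) chart set"
  assumes A: "smooth_structure A" "c \<in> A" "p \<in> chart_dom c"
    and B: "smooth_structure B" "d \<in> B" "f p \<in> chart_dom d" and f: "smooth_map A B f"
  shows "pushforward A B f p (tangent_of A c p x) d =
    frechet_derivative (\<lambda>z. coord d (f (param c z))) (at (coord c p)) x"
proof -
  let ?e = "chart_at A p"
  have e: "?e \<in> A" "p \<in> chart_dom ?e"
    using smooth_structure_chart_at A by blast+
  have "(\<lambda>z. coord d (f (param ?e z))) differentiable (at (coord ?e p))"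
    by (rule smooth_map_differentiable[OF f e B(2,3)])
  then have "((\<lambda>z. coord d (f (param ?e z))) has_derivative
      frechet_derivative (\<lambda>z. coord d (f (param ?e z))) (at (coord ?e p))) (at (coord ?e p))"
    by (simp add: frechet_derivative_works)
  from has_derivative_change_chart[OF A(1,2) e(1) A(3) e(2), of "\<lambda>q. coord d (f q)", OF this]
  have "(\<lambda>x. frechet_derivative (\<lambda>z. coord d (f (param ?e z))) (at (coord ?e p)) (jac c ?e p x))
      = frechet_derivative (\<lambda>z. coord d (f (param c z))) (at (coord c p))"
    by (rule frechet_derivative_at)
  with e B show ?thesis by (simp add: pushforward_def tangent_of_def Let_def fun_eq_iff)
qed

lemma
  assumes B: "smooth_structure B" "d \<in> B" and f: "smooth_map A B f"
  shows open_vimage_chart_dom: "open (f -` chart_dom d)"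
    and open_coord_image_vimage: "smooth_structure A \<Longrightarrow> c \<in> A \<Longrightarrow>
      open (coord c ` (chart_dom c \<inter> f -` chart_dom d))"
proof -
  show "open (f -` chart_dom d)"
    using f open_chart_dom[OF B] unfolding smooth_map_def
    by (simp add: continuous_on_open_vimage)
  then show "open (coord c ` (chart_dom c \<inter> f -` chart_dom d))"
    if "smooth_structure A" "c \<in> A"
    using that open_coord_image by blast
qed

text \<open>Here the target chart changes: the map in coordinates is followed by a transition map,
  whose Jacobian is the one demanded by \<open>tangent_space\<close>.\<close>

lemma pushforward_in_tangent_space:
  fixes A :: "('m::topological_space, 'k::finite) chart set"
    and B :: "('n::topological_space, 'l::finite) chart set"
  assumes A: "smooth_structure A" and B: "smooth_structure B" and f: "smooth_map A B f"
  shows "pushforward A B f p X \<in> tangent_space B (f p)"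
proof -
  let ?e = "chart_at A p"
  have e: "?e \<in> A" "p \<in> chart_dom ?e"
    using smooth_structure_chart_at A by blast+
  have "frechet_derivative (\<lambda>z. coord d (f (param ?e z))) (at (coord ?e p)) x =
      jac c d (f p) (frechet_derivative (\<lambda>z. coord c (f (param ?e z))) (at (coord ?e p)) x)"
    if cd: "c \<in> B" "d \<in> B" "f p \<in> chart_dom c" "f p \<in> chart_dom d" for c d x
  proof -
    let ?F = "\<lambda>z. coord c (f (param ?e z))"
    have F: "(?F has_derivative frechet_derivative ?F (at (coord ?e p))) (at (coord ?e p))"
      using smooth_map_differentiable[OF f e cd(1,3)] by (simp add: frechet_derivative_works)
    have "(transition c d has_derivative jac c d (f p)) (at (?F (coord ?e p)))"
      using has_derivative_jac[OF B cd] A e by (simp add: param_coord)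
    from diff_chain_at[OF F this]
    have "((\<lambda>z. transition c d (?F z)) has_derivative
        (\<lambda>x. jac c d (f p) (frechet_derivative ?F (at (coord ?e p)) x))) (at (coord ?e p))"
      by (simp add: o_def)
    then have "((\<lambda>z. coord d (f (param ?e z))) has_derivative
        (\<lambda>x. jac c d (f p) (frechet_derivative ?F (at (coord ?e p)) x))) (at (coord ?e p))"
    proof (rule has_derivative_transform_within_open)
      show "open (coord ?e ` (chart_dom ?e \<inter> f -` chart_dom c))"
        using open_coord_image_vimage[OF B cd(1) f A e(1)] .
    qed (use e cd A B in \<open>auto simp: transition_def param_coord\<close>)
    then show ?thesis by (metis frechet_derivative_at)
  qed
  note * = this
  show ?thesis
  proof (rule tangent_spaceI)
    fix c d assume "c \<in> B" "d \<in> B" "f p \<in> chart_dom c" "f p \<in> chart_dom d"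
    with *[OF this] show "pushforward A B f p X d = jac c d (f p) (pushforward A B f p X c)"
      by (simp add: pushforward_def Let_def)
  qed (auto simp: pushforward_def)
qed

lemma pushforward_tangent_of_linear:
  fixes A :: "('m::topological_space, 'k::finite) chart set"
    and B :: "('n::topological_space, 'l::finite) chart set"
  assumes A: "smooth_structure A" "c \<in> A" "p \<in> chart_dom c"
    and B: "smooth_structure B" "d \<in> B" "f p \<in> chart_dom d" and f: "smooth_map A B f"
  shows "linear (\<lambda>x. pushforward A B f p (tangent_of A c p x) d)"
  unfolding pushforward_tangent_of[OF assms]
  using smooth_map_differentiable[OF f A(2,3) B(2,3)] linear_frechet_derivative by blast

text \<open>The chain rule for the transition map. Differentiability at the single time
  \<open>t\<close> is the form in which it applies both to the singular curve and to its image in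
  the target.\<close>

lemma velocity_in_tangent_space:
  assumes A: "smooth_structure A" and S: "open S" "t \<in> S" "continuous_on S \<gamma>"
    and \<gamma>: "\<And>c. c \<in> A \<Longrightarrow> \<gamma> t \<in> chart_dom c \<Longrightarrow> (\<lambda>r. coord c (\<gamma> r)) differentiable (at t)"
  shows "velocity A \<gamma> t \<in> tangent_space A (\<gamma> t)"
proof -
  have "vector_derivative (\<lambda>r. coord d (\<gamma> r)) (at t) =
      jac c d (\<gamma> t) (vector_derivative (\<lambda>r. coord c (\<gamma> r)) (at t))"
    if cd: "c \<in> A" "d \<in> A" "\<gamma> t \<in> chart_dom c" "\<gamma> t \<in> chart_dom d" for c d
  proof (rule vector_derivative_at)
    let ?D = "jac c d (\<gamma> t) (vector_derivative (\<lambda>r. coord c (\<gamma> r)) (at t))"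
    have "((\<lambda>r. coord c (\<gamma> r)) has_vector_derivative
        vector_derivative (\<lambda>r. coord c (\<gamma> r)) (at t)) (at t)"
      using \<gamma> cd by (simp add: vector_derivative_works)
    from vector_derivative_diff_chain_within[OF this, of "transition c d"]
      has_derivative_jac[OF A cd]
    have "((\<lambda>r. transition c d (coord c (\<gamma> r))) has_vector_derivative ?D) (at t)"
      by (simp add: o_def has_derivative_at_withinI)
    moreover have "open (S \<inter> \<gamma> -` chart_dom c)"
      using continuous_on_open_vimage[OF S(1), of \<gamma>] S(3) open_chart_dom[OF A cd(1)]
      by (simp add: Int_commute)
    ultimately show "((\<lambda>r. coord d (\<gamma> r)) has_vector_derivative ?D) (at t)"
      by (rule has_vector_derivative_transform_within_open)
        (use cd A S in \<open>auto simp: transition_def param_coord\<close>)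
  qed
  note * = this
  show ?thesis
  proof (rule tangent_spaceI)
    fix c d assume "c \<in> A" "d \<in> A" "\<gamma> t \<in> chart_dom c" "\<gamma> t \<in> chart_dom d"
    with *[OF this] show "velocity A \<gamma> t d = jac c d (\<gamma> t) (velocity A \<gamma> t c)"
      by (simp add: velocity_def)
  qed (auto simp: velocity_def)
qed

section \<open>Determinants\<close>

lemma det_vector_2: "det (vector [x, y] :: real ^ 2 ^ 2) = x $ 1 * y $ 2 - x $ 2 * y $ 1"
  by (simp add: det_2)

lemma det_vector_3:
  "det (vector [x, y, z] :: real ^ 3 ^ 3) =
    x $ 1 * (y $ 2 * z $ 3 - y $ 3 * z $ 2) - x $ 2 * (y $ 1 * z $ 3 - y $ 3 * z $ 1) +
    x $ 3 * (y $ 1 * z $ 2 - y $ 2 * z $ 1)"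
  by (simp add: det_3 algebra_simps)

lemma det_linear_vector_2:
  fixes L :: "real ^ 2 \<Rightarrow> real ^ 2"
  assumes "linear L"
  shows "det (vector [L x, L y] :: real ^ 2 ^ 2) = det (matrix L) * det (vector [x, y] :: real ^ 2 ^ 2)"
  unfolding det_vector_2 det_2 linear_eq_sum_axis[OF assms, of x] linear_eq_sum_axis[OF assms, of y]
  by (simp add: sum_2 matrix_def algebra_simps)

text \<open>\<open>vector\<close> lists the vectors as rows, so \<open>L\<close> acts by its
  transposed matrix from the right and the determinant is multiplicative.\<close>

lemma det_linear_vector_3:
  fixes L :: "real ^ 3 \<Rightarrow> real ^ 3"
  assumes "linear L"
  shows "det (vector [L x, L y, L z] :: real ^ 3 ^ 3) =
    det (matrix L) * det (vector [x, y, z] :: real ^ 3 ^ 3)"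
proof -
  have "vector [L x, L y, L z] = (vector [x, y, z] :: real ^ 3 ^ 3) ** transpose (matrix L)"
    using linear_eq_sum_axis[OF assms, of x] linear_eq_sum_axis[OF assms, of y]
      linear_eq_sum_axis[OF assms, of z]
    by (simp add: vec_eq_iff forall_3 matrix_matrix_mult_def transpose_def matrix_def sum_3)
  then show ?thesis by (simp add: det_mul mult.commute)
qed

text \<open>The first two rows are combinations of the old ones with the entries of the matrix of
  \<open>K\<close> as coefficients. In the application \<open>K\<close> is the Jacobian of a
  coordinate change and \<open>L\<close> the differential of the front.\<close>

lemma det_linear_frame:
  fixes L :: "real ^ 2 \<Rightarrow> real ^ 3" and K :: "real ^ 2 \<Rightarrow> real ^ 2"
  assumes "linear L"
  shows "det (vector [L (K (axis 1 1)), L (K (axis 2 1)), z] :: real ^ 3 ^ 3) =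
    det (matrix K) * det (vector [L (axis 1 1), L (axis 2 1), z] :: real ^ 3 ^ 3)"
  unfolding det_vector_3 det_2 linear_eq_sum_axis[OF assms, of "K (axis 1 1)"]
    linear_eq_sum_axis[OF assms, of "K (axis 2 1)"]
  by (simp add: sum_2 matrix_def algebra_simps)

text \<open>The coordinates of \<open>x\<close> are the coefficients of a linear relation between
  the first two rows. Both multiples of the determinant by them vanish, and one coefficient is
  nonzero.\<close>

lemma det_linear_frame_eq_0:
  fixes L :: "real ^ 2 \<Rightarrow> real ^ 3"
  assumes "linear L" "L x = 0" "x \<noteq> 0"
  shows "det (vector [L (axis 1 1), L (axis 2 1), z] :: real ^ 3 ^ 3) = 0"
proof -
  let ?u = "L (axis 1 1)" and ?v = "L (axis 2 1)"
  have "x $ 1 *\<^sub>R ?u + x $ 2 *\<^sub>R ?v = 0"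
    using linear_eq_sum_axis[OF assms(1), of x] assms(2) by (simp add: sum_2)
  then have *: "x $ 1 * ?u $ i + x $ 2 * ?v $ i = 0" for i
    by (metis vector_add_component vector_scaleR_component zero_index real_scaleR_def)
  let ?D = "det (vector [?u, ?v, z] :: real ^ 3 ^ 3)"
  have "x $ 1 * ?D = 0" "x $ 2 * ?D = 0"
    unfolding det_vector_3 using *[of 1] *[of 2] *[of 3] by algebra+
  moreover have "x $ 1 \<noteq> 0 \<or> x $ 2 \<noteq> 0"
    using assms(3) by (auto simp: vec_eq_iff forall_2)
  ultimately show ?thesis by auto
qed

text \<open>The matrix under the root in \<open>volume_form\<close>, isolated so that congruence and
  nondegeneracy can be treated for a bare bilinear form.\<close>

definition gram :: "(real ^ 'k \<Rightarrow> real ^ 'k \<Rightarrow> real) \<Rightarrow> real ^ 'k ^ 'k"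
  where "gram B = (\<chi> i j. B (axis i 1) (axis j 1))"

lemma bilinear_eq_sum_gram:
  assumes "bilinear B"
  shows "B x y = (\<Sum>i\<in>UNIV. \<Sum>j\<in>UNIV. x $ i * gram B $ i $ j * y $ j)"
proof -
  have l: "linear (\<lambda>x. B x y)" "linear (B x)" for x y
    using assms unfolding bilinear_def by auto
  have "B x y = (\<Sum>i\<in>UNIV. x $ i * B (axis i 1) y)"
    using linear_eq_sum_axis[OF l(1), of x y] by simp
  also have "\<dots> = (\<Sum>i\<in>UNIV. \<Sum>j\<in>UNIV. x $ i * gram B $ i $ j * y $ j)"
    using linear_eq_sum_axis[OF l(2), of "axis _ 1" y]
    by (simp add: gram_def sum_distrib_left algebra_simps)
  finally show ?thesis .
qed

lemma gram_compose:
  assumes "bilinear B"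
  shows "gram (\<lambda>x y. B (L x) (L y)) = transpose (matrix L) ** gram B ** matrix L"
proof -
  have "gram (\<lambda>x y. B (L x) (L y)) $ i $ j = (transpose (matrix L) ** gram B ** matrix L) $ i $ j"
    for i j
  proof -
    have "gram (\<lambda>x y. B (L x) (L y)) $ i $ j = B (L (axis i 1)) (L (axis j 1))"
      by (simp add: gram_def)
    also have "\<dots> = (\<Sum>k\<in>UNIV. \<Sum>l\<in>UNIV. L (axis i 1) $ k * gram B $ k $ l * L (axis j 1) $ l)"
      by (rule bilinear_eq_sum_gram[OF assms])
    \<comment> \<open>The matrix product associates to the left, so its outer sum runs over the
      column index of the Gram matrix.\<close>
    also have "\<dots> = (\<Sum>l\<in>UNIV. \<Sum>k\<in>UNIV. L (axis i 1) $ k * gram B $ k $ l * L (axis j 1) $ l)"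
      by (rule sum.swap)
    finally show ?thesis
      by (simp add: matrix_matrix_mult_def transpose_def matrix_def sum_distrib_right)
  qed
  then show ?thesis by (simp add: vec_eq_iff)
qed

text \<open>A nonzero vector \<open>x\<close> in the kernel of the Gram matrix would give
  \<open>B x x = 0\<close>.\<close>

lemma det_gram_nonzero:
  assumes "bilinear B" "\<And>x. x \<noteq> 0 \<Longrightarrow> B x x > 0"
  shows "det (gram B) \<noteq> 0"
proof
  assume "det (gram B) = 0"
  then have "\<not> invertible (gram B)" by (simp add: invertible_det_nz)
  then obtain x where x: "x \<noteq> 0" "gram B *v x = 0"
    unfolding invertible_left_inverse matrix_left_invertible_ker by blast
  have "B x x = (\<Sum>i\<in>UNIV. x $ i * (gram B *v x) $ i)"
    unfolding bilinear_eq_sum_gram[OF assms(1), of x x]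
    by (simp add: matrix_vector_mult_def sum_distrib_left mult.assoc)
  also have "\<dots> = 0" using x by simp
  finally show False using assms(2)[OF x(1)] by simp
qed

section \<open>Differentiability of determinants and roots\<close>

lemma differentiable_det_vector_3:
  assumes "a differentiable (at x)" "b differentiable (at x)" "c differentiable (at x)"
  shows "(\<lambda>z. det (vector [a z, b z, c z] :: real ^ 3 ^ 3)) differentiable (at x)"
  unfolding det_vector_3
  by (intro differentiable_add differentiable_diff differentiable_mult differentiable_vec_nth assms)

lemma differentiable_det_3:
  fixes h :: "'a::real_normed_vector \<Rightarrow> real ^ 3 ^ 3"
  assumes "\<And>i j. (\<lambda>z. h z $ i $ j) differentiable (at x)"
  shows "(\<lambda>z. det (h z)) differentiable (at x)"
  unfolding det_3
  by (intro differentiable_add differentiable_diff differentiable_mult assms)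

lemma differentiable_det_2:
  fixes h :: "'a::real_normed_vector \<Rightarrow> real ^ 2 ^ 2"
  assumes "\<And>i j. (\<lambda>z. h z $ i $ j) differentiable (at x)"
  shows "(\<lambda>z. det (h z)) differentiable (at x)"
  unfolding det_2
  by (intro differentiable_diff differentiable_mult assms)

text \<open>\<open>sqrt\<close> is extended to negative numbers as an odd function, hence
  differentiable at every nonzero argument; a nonvanishing Gram determinant therefore suffices
  later.\<close>

lemma differentiable_sqrt:
  assumes "h differentiable (at x)" "h x \<noteq> 0"
  shows "(\<lambda>z. sqrt (h z)) differentiable (at x)"
proof -
  have "(sqrt has_real_derivative
      (if h x > 0 then inverse (sqrt (h x)) / 2 else - inverse (sqrt (h x)) / 2)) (at (h x))"
    using assms(2) by (intro DERIV_real_sqrt_generic) auto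
  then have "sqrt differentiable (at (h x))"
    unfolding real_differentiable_def by blast
  from differentiable_chain_at[OF assms(1) this] show ?thesis by (simp add: o_def)
qed

section \<open>Volume form and area density\<close>

lemma volume_form_gram:
  "volume_form A Or g p X Y Z = (let c = chart_at Or p in
    sqrt (det (gram (metric_in A g c p))) * det (vector [X c, Y c, Z c] :: real ^ 3 ^ 3))"
  by (simp add: volume_form_def gram_def)

text \<open>Frees the volume form from its chosen chart: the factor by which the root of the Gram
  determinant changes is compensated by that of the component determinant.\<close>

lemma volume_form_eq:
  assumes A: "smooth_structure A" "orientation A Or" and g: "riemannian_metric A g"
    and c: "c \<in> Or" "p \<in> chart_dom c"
    and X: "X \<in> tangent_space A p" "Y \<in> tangent_space A p" "Z \<in> tangent_space A p"
  shows "volume_form A Or g p X Y Z =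
    sqrt (det (gram (metric_in A g c p))) * det (vector [X c, Y c, Z c] :: real ^ 3 ^ 3)"
proof -
  let ?e = "chart_at Or p"
  let ?J = "matrix (jac c ?e p)"
  have e: "?e \<in> Or" "p \<in> chart_dom ?e"
    using chart_at_mem[OF c] chart_at_dom[OF c] by auto
  have Or: "Or \<subseteq> A" and pos: "det ?J > 0"
    using A(2) c e unfolding orientation_def positively_compatible_def by auto
  have ce: "c \<in> A" "?e \<in> A" using c e Or by auto
  have "bilinear (metric_in A g ?e p)"
    using g ce e unfolding riemannian_metric_def by blast
  from gram_compose[OF this, of "jac c ?e p"]
  have "gram (metric_in A g c p) = transpose ?J ** gram (metric_in A g ?e p) ** ?J"
    using metric_in_change_chart[OF A(1) ce c(2) e(2), of g]
    by (simp add: gram_def)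
  then have "det (gram (metric_in A g c p)) = (det ?J)\<^sup>2 * det (gram (metric_in A g ?e p))"
    by (simp add: det_mul power2_eq_square)
  \<comment> \<open>The orientation enters here: \<open>?J\<close> has positive determinant, so the
    root of its square is the determinant itself, without a modulus.\<close>
  then have "sqrt (det (gram (metric_in A g c p))) =
      det ?J * sqrt (det (gram (metric_in A g ?e p)))"
    using pos by (simp add: real_sqrt_mult)
  moreover have "det (vector [X ?e, Y ?e, Z ?e] :: real ^ 3 ^ 3) =
      det ?J * det (vector [X c, Y c, Z c] :: real ^ 3 ^ 3)"
    unfolding X[THEN tangent_space_jac, OF ce c(2) e(2)]
    by (rule det_linear_vector_3[OF linear_jac[OF A(1) ce c(2) e(2)]])
  ultimately show ?thesis
    by (simp add: volume_form_gram Let_def)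
qed

text \<open>Multilinearity, with the \<open>b\<close> term killed by alternation. In the application
  \<open>a\<close> and \<open>b\<close> are the first and second derivatives of the parameter change
  and \<open>k\<close> is the sign of the normal.\<close>

lemma volume_form_change_frame:
  "volume_form A Or g p (\<lambda>c. a *\<^sub>R X c) (\<lambda>c. a\<^sup>2 *\<^sub>R Y c + b *\<^sub>R X c) (\<lambda>c. k *\<^sub>R Z c) =
    a ^ 3 * k * volume_form A Or g p X Y Z"
  unfolding volume_form_gram Let_def det_vector_3
  by (simp add: algebra_simps power2_eq_square power3_eq_cube)

lemma area_density_scale_normal:
  "area_density AM AN ON g f (\<lambda>p d. k *\<^sub>R \<nu> p d) c q = k * area_density AM AN ON g f \<nu> c q"
  unfolding area_density_def volume_form_gram Let_def det_vector_3
  by (simp add: algebra_simps)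

text \<open>In the fixed target chart \<open>chart_at ON (f q)\<close> both facts concern one
  determinant of order 3 whose first two rows come from the differential of \<open>f\<close>. The
  charts on the surface range over \<open>AM\<close>, so the Jacobian determinant may be negative,
  as under a change of orientation.\<close>

lemma
  fixes AM :: "('m::topological_space, 2) chart set" and AN ON :: "('n::topological_space, 3) chart set"
  assumes M: "smooth_structure AM" and N: "smooth_structure AN" "orientation AN ON"
    and f: "smooth_map AM AN f" and c: "c \<in> AM" "q \<in> chart_dom c"
  shows area_density_change_chart:
      "c' \<in> AM \<Longrightarrow> q \<in> chart_dom c' \<Longrightarrow> area_density AM AN ON g f \<nu> c' q =
        det (matrix (jac c' c q)) * area_density AM AN ON g f \<nu> c q"
    and area_density_eq_0:
      "X \<in> tangent_space AM q \<Longrightarrow> X c \<noteq> 0 \<Longrightarrow> pushforward AM AN f q X = (\<lambda>_. 0) \<Longrightarrow>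
        area_density AM AN ON g f \<nu> c q = 0"
proof -
  let ?e = "chart_at ON (f q)"
  have "f q \<in> (\<Union>d\<in>ON. chart_dom d)" and ON: "ON \<subseteq> AN"
    using N(2) unfolding orientation_def by auto
  then have e: "?e \<in> AN" "f q \<in> chart_dom ?e"
    using chart_at_mem[of _ ON "f q"] chart_at_dom[of _ ON "f q"] by blast+
  let ?L = "\<lambda>x. pushforward AM AN f q (tangent_of AM c q x) ?e"
  have L: "linear ?L"
    by (rule pushforward_tangent_of_linear[OF M c N(1) e f])
  show "area_density AM AN ON g f \<nu> c' q =
      det (matrix (jac c' c q)) * area_density AM AN ON g f \<nu> c q"
    if c': "c' \<in> AM" "q \<in> chart_dom c'"
    using det_linear_frame[OF L, of "jac c' c q" "\<nu> q ?e"]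
      tangent_of_change_chart[OF M c'(1) c(1) c'(2) c(2)]
    by (simp add: area_density_def volume_form_gram Let_def)
  show "area_density AM AN ON g f \<nu> c q = 0"
    if X: "X \<in> tangent_space AM q" "X c \<noteq> 0" "pushforward AM AN f q X = (\<lambda>_. 0)"
    using det_linear_frame_eq_0[OF L _ X(2)] tangent_of_eq[OF M c X(1)] X(3)
    by (simp add: area_density_def volume_form_gram)
qed

text \<open>The chart chosen in \<open>volume_form\<close> may jump as the point moves. Near
  \<open>p\<close> it is replaced by one fixed chart \<open>d\<close>, where the density is a
  product of a root and a determinant of differentiable functions.\<close>

lemma area_density_differentiable:
  fixes AM :: "('m::topological_space, 2) chart set" and AN ON :: "('n::topological_space, 3) chart set"
  assumes M: "smooth_structure AM"
    and N: "smooth_structure AN" "orientation AN ON" "riemannian_metric AN g"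
    and f: "smooth_map AM AN f" and \<nu>: "unit_normal_field AM AN g f \<nu>"
    and c: "c \<in> AM" "p \<in> chart_dom c"
  shows "(\<lambda>z. area_density AM AN ON g f \<nu> c (param c z)) differentiable (at (coord c p))"
proof -
  have ON: "ON \<subseteq> AN" "f p \<in> (\<Union>d\<in>ON. chart_dom d)"
    using N(2) unfolding orientation_def by auto
  then obtain d where d: "d \<in> ON" "d \<in> AN" "f p \<in> chart_dom d" by blast
  let ?W = "coord c ` (chart_dom c \<inter> f -` chart_dom d)"
  let ?F = "\<lambda>z. coord d (f (param c z))"
  let ?G = "\<lambda>w. gram (metric_in AN g d (param d w))"
  have W: "open ?W" "coord c p \<in> ?W"
    using open_coord_image_vimage[OF N(1) d(2) f M c(1)] c d by auto
  have F: "smooth_on ?W ?F"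
    using f c d unfolding smooth_map_def by blast
  have "smooth_on ?W (\<lambda>z. \<nu> (param c z) d)"
    using \<nu> c d unfolding unit_normal_field_def by blast
  then have \<nu>W: "(\<lambda>z. \<nu> (param c z) d) differentiable (at (coord c p))"
    using smooth_on_differentiable W by blast
  have DF: "(\<lambda>z. frechet_derivative ?F (at z) v) differentiable (at (coord c p))" for v
    using smooth_on_differentiable[OF smooth_on_frechet_derivative[OF F] W(2)] .
  have Fp: "?F differentiable (at (coord c p))" "?F (coord c p) = coord d (f p)"
    using smooth_on_differentiable[OF F W(2)] M c by (auto simp: param_coord)
  have "(\<lambda>w. ?G w $ i $ j) differentiable (at (?F (coord c p)))" for i j
  proof -
    have "smooth_on (coord d ` chart_dom d) (\<lambda>w. metric_in AN g d (param d w) (axis i 1) (axis j 1))"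
      using N(3) d unfolding riemannian_metric_def by blast
    from smooth_on_differentiable[OF this, of "coord d (f p)"] show ?thesis
      using d Fp by (simp add: gram_def)
  qed
  then have "(\<lambda>w. det (?G w)) differentiable (at (?F (coord c p)))"
    by (rule differentiable_det_3)
  from differentiable_chain_at[OF Fp(1) this]
  have G: "(\<lambda>z. det (?G (?F z))) differentiable (at (coord c p))" by (simp add: o_def)
  have "det (gram (metric_in AN g d (f p))) \<noteq> 0"
    using N(3) d by (intro det_gram_nonzero) (auto simp: riemannian_metric_def)
  then have "det (?G (?F (coord c p))) \<noteq> 0"
    using N d Fp(2) by (simp add: param_coord)
  note sqrt = differentiable_sqrt[OF G this]
  have "(\<lambda>z. sqrt (det (?G (?F z))) * det (vector [frechet_derivative ?F (at z) (axis 1 1),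
      frechet_derivative ?F (at z) (axis 2 1), \<nu> (param c z) d] :: real ^ 3 ^ 3))
      differentiable (at (coord c p))"
    by (intro differentiable_mult sqrt differentiable_det_vector_3 DF \<nu>W)
  then show ?thesis
    using W
  proof (rule differentiable_transform_open)
    fix z assume "z \<in> ?W"
    then obtain q where q: "q \<in> chart_dom c" "f q \<in> chart_dom d" "z = coord c q" "param c z = q"
      using M c by (auto simp: param_coord)
    have "\<nu> q \<in> tangent_space AN (f q)"
      using \<nu> unfolding unit_normal_field_def by blast
    with q show "sqrt (det (?G (?F z))) * det (vector [frechet_derivative ?F (at z) (axis 1 1),
        frechet_derivative ?F (at z) (axis 2 1), \<nu> (param c z) d] :: real ^ 3 ^ 3) =
        area_density AM AN ON g f \<nu> c (param c z)"
      unfolding area_density_def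
      by (simp add: param_coord[OF N(1) d(2)] pushforward_tangent_of[OF M c(1) q(1) N(1) d(2) q(2) f]
        volume_form_eq[OF N d(1)] pushforward_in_tangent_space[OF M N(1) f])
  qed
qed

lemma det_jac_differentiable:
  fixes A :: "('m::topological_space, 2) chart set"
  assumes A: "smooth_structure A" "c \<in> A" "d \<in> A" "p \<in> chart_dom c" "p \<in> chart_dom d"
  shows "(\<lambda>z. det (matrix (jac c d (param c z)))) differentiable (at (coord c p))"
proof -
  let ?W = "coord c ` (chart_dom c \<inter> chart_dom d)"
  have W: "open ?W" "coord c p \<in> ?W"
    using open_coord_image open_chart_dom A by blast+
  have "smooth_on ?W (transition c d)"
    using A unfolding smooth_structure_def smoothly_compatible_def by blast
  note D = smooth_on_differentiable[OF smooth_on_frechet_derivative[OF this] W(2)]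
  have "(\<lambda>z. det (matrix (frechet_derivative (transition c d) (at z)))) differentiable (at (coord c p))"
    by (rule differentiable_det_2) (simp add: matrix_def differentiable_vec_nth D)
  then show ?thesis
    using W by (rule differentiable_transform_open) (use A in \<open>auto simp: jac_def param_coord\<close>)
qed

lemma area_density_derivative_change_chart:
  fixes AM :: "('m::topological_space, 2) chart set" and AN ON :: "('n::topological_space, 3) chart set"
  assumes M: "smooth_structure AM"
    and N: "smooth_structure AN" "orientation AN ON" "riemannian_metric AN g"
    and f: "smooth_map AM AN f" and \<nu>: "unit_normal_field AM AN g f \<nu>"
    and c: "c \<in> AM" "p \<in> chart_dom c" and c': "c' \<in> AM" "p \<in> chart_dom c'"
    and 0: "area_density AM AN ON g f \<nu> c p = 0"
  shows "((\<lambda>z. area_density AM AN ON g f \<nu> c' (param c' z)) has_derivative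
    (\<lambda>x. det (matrix (jac c' c p)) *
      frechet_derivative (\<lambda>z. area_density AM AN ON g f \<nu> c (param c z)) (at (coord c p))
        (jac c' c p x))) (at (coord c' p))"
proof -
  let ?k = "area_density AM AN ON g f \<nu>"
  let ?D = "frechet_derivative (\<lambda>z. ?k c (param c z)) (at (coord c p))"
  let ?h = "\<lambda>z. det (matrix (jac c' c (param c' z)))"
  have "((\<lambda>z. ?k c (param c z)) has_derivative ?D) (at (coord c p))"
    using area_density_differentiable[OF M N f \<nu> c] by (simp add: frechet_derivative_works)
  from has_derivative_change_chart[OF M c'(1) c(1) c'(2) c(2), of "?k c", OF this]
  have k: "((\<lambda>z. ?k c (param c' z)) has_derivative (\<lambda>x. ?D (jac c' c p x))) (at (coord c' p))" .
  have "(?h has_derivative frechet_derivative ?h (at (coord c' p))) (at (coord c' p))"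
    using det_jac_differentiable[OF M c'(1) c(1) c'(2) c(2)] by (simp add: frechet_derivative_works)
  \<comment> \<open>Of the two terms of the product rule, the one with the derivative of
    \<open>?h\<close> carries the factor \<open>?k c p\<close>, which is zero.\<close>
  from has_derivative_mult[OF this k]
  have "((\<lambda>z. ?h z * ?k c (param c' z)) has_derivative
      (\<lambda>x. det (matrix (jac c' c p)) * ?D (jac c' c p x))) (at (coord c' p))"
    using 0 param_coord[OF M c'] by simp
  then show ?thesis
  proof (rule has_derivative_transform_within_open)
    show "open (coord c' ` (chart_dom c' \<inter> chart_dom c))"
      using open_coord_image[OF M c'(1) open_chart_dom[OF M c(1)]] .
    show "coord c' p \<in> coord c' ` (chart_dom c' \<inter> chart_dom c)"
      using c c' by blast
    show "?h z * ?k c (param c' z) = ?k c' (param c' z)"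
      if "z \<in> coord c' ` (chart_dom c' \<inter> chart_dom c)" for z
      using that M c c' area_density_change_chart[OF M N(1,2) f c(1) _ c'(1)]
      by (auto simp: param_coord)
  qed
qed

section \<open>Reparametrization of curves\<close>

text \<open>Supplies what the acceleration of the image curve requires in one target chart: a first
  derivative near \<open>t\<close> and a second one at \<open>t\<close>. The neighbourhood consists
  of the times at which the curve stays in a source chart and its image in \<open>d\<close>.\<close>

lemma smooth_map_curve:
  fixes AM :: "('m::topological_space, 'k::finite) chart set"
    and AN :: "('n::topological_space, 'l::finite) chart set"
  assumes M: "smooth_structure AM" and N: "smooth_structure AN" and f: "smooth_map AM AN f"
    and \<gamma>: "smooth_curve AM I \<gamma>" "open I" "t \<in> I" and d: "d \<in> AN" "f (\<gamma> t) \<in> chart_dom d"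
  obtains I' where "open I'" "t \<in> I'" "I' \<subseteq> I"
    "\<And>r. r \<in> I' \<Longrightarrow> (\<lambda>r. coord d (f (\<gamma> r))) differentiable (at r)"
    "(\<lambda>r. vector_derivative (\<lambda>q. coord d (f (\<gamma> q))) (at r)) differentiable (at t)"
proof
  let ?c = "chart_at AM (\<gamma> t)"
  let ?F = "\<lambda>z. coord d (f (param ?c z))" and ?u = "\<lambda>r. coord ?c (\<gamma> r)"
  let ?U = "coord ?c ` (chart_dom ?c \<inter> f -` chart_dom d)"
  let ?S = "I \<inter> \<gamma> -` (chart_dom ?c \<inter> f -` chart_dom d)"
  have c: "?c \<in> AM" "\<gamma> t \<in> chart_dom ?c"
    using smooth_structure_chart_at[OF M] by auto
  have "open (f -` chart_dom d)"
    by (rule open_vimage_chart_dom[OF N d(1) f])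
  then have "open (chart_dom ?c \<inter> f -` chart_dom d)"
    using open_chart_dom[OF M c(1)] by blast
  then show S: "open ?S"
    using continuous_on_open_vimage[OF \<gamma>(2), of \<gamma>] \<gamma>(1) unfolding smooth_curve_def
    by (metis Int_commute)
  show t: "t \<in> ?S" using \<gamma> c d by simp
  show "?S \<subseteq> I" by blast
  have F: "smooth_on ?U ?F"
    using f c d unfolding smooth_map_def by blast
  have "smooth_on (I \<inter> \<gamma> -` chart_dom ?c) ?u"
    using \<gamma>(1) c unfolding smooth_curve_def by blast
  then have u: "smooth_on ?S ?u"
    by (rule smooth_on_subset) blast
  have "?u ` ?S \<subseteq> ?U" by (intro image_subsetI imageI) simp
  note comp = smooth_compose_curve_derivative_differentiable[OF F u S this]
  have eq: "?F (?u r) = coord d (f (\<gamma> r))" if "r \<in> ?S" for r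
    using that M c by (simp add: param_coord)
  show "(\<lambda>r. coord d (f (\<gamma> r))) differentiable (at r)" if "r \<in> ?S" for r
    using differentiable_transform_open[OF comp(1)[OF that] S that eq] .
  have "vector_derivative (\<lambda>q. ?F (?u q)) (at r) = vector_derivative (\<lambda>q. coord d (f (\<gamma> q))) (at r)"
    if "r \<in> ?S" for r
    using eq eventually_nhds_in_open[OF S that]
    by (intro vector_derivative_cong_eq) (auto elim: eventually_mono)
  from differentiable_transform_open[OF comp(2)[OF t] S t this]
  show "(\<lambda>r. vector_derivative (\<lambda>q. coord d (f (\<gamma> q))) (at r)) differentiable (at t)" .
qed

lemma velocity_reparametrize:
  assumes "s differentiable (at t)"
    and "\<And>c. c \<in> A \<Longrightarrow> \<gamma> (s t) \<in> chart_dom c \<Longrightarrow> (\<lambda>r. coord c (\<gamma> r)) differentiable (at (s t))"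
  shows "velocity A (\<lambda>r. \<gamma> (s r)) t = (\<lambda>c. vector_derivative s (at t) *\<^sub>R velocity A \<gamma> (s t) c)"
proof
  fix c
  show "velocity A (\<lambda>r. \<gamma> (s r)) t c = vector_derivative s (at t) *\<^sub>R velocity A \<gamma> (s t) c"
  proof (cases "c \<in> A \<and> \<gamma> (s t) \<in> chart_dom c")
    case True
    with vector_derivative_at[OF vector_derivative_compose[OF assms]] show ?thesis
      by (simp add: velocity_def)
  qed (auto simp: velocity_def)
qed

text \<open>The connection term is quadratic in the velocity and so scales by the same square as the
  second derivative; only the second derivative of \<open>s\<close> adds a multiple of the
  velocity.\<close>

lemma acceleration_reparametrize:
  assumes \<Gamma>: "affine_connection A \<Gamma>"
    and J: "open J" "t \<in> J" and s: "smooth_on J s"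
    and \<gamma>: "\<And>c. c \<in> A \<Longrightarrow> \<gamma> (s t) \<in> chart_dom c \<Longrightarrow> \<exists>I'. open I' \<and> s t \<in> I' \<and>
      (\<forall>r\<in>I'. (\<lambda>r. coord c (\<gamma> r)) differentiable (at r)) \<and>
      (\<lambda>r. vector_derivative (\<lambda>q. coord c (\<gamma> q)) (at r)) differentiable (at (s t))"
  shows "acceleration A \<Gamma> (\<lambda>r. \<gamma> (s r)) t = (\<lambda>c.
    (vector_derivative s (at t))\<^sup>2 *\<^sub>R acceleration A \<Gamma> \<gamma> (s t) c +
    vector_derivative (\<lambda>r. vector_derivative s (at r)) (at t) *\<^sub>R velocity A \<gamma> (s t) c)"
proof
  fix c
  let ?s' = "vector_derivative s (at t)"
  have sd: "s differentiable (at r)" if "r \<in> J" for r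
    using smooth_on_differentiable[OF s that] .
  show "acceleration A \<Gamma> (\<lambda>r. \<gamma> (s r)) t c =
    ?s'\<^sup>2 *\<^sub>R acceleration A \<Gamma> \<gamma> (s t) c +
    vector_derivative (\<lambda>r. vector_derivative s (at r)) (at t) *\<^sub>R velocity A \<gamma> (s t) c"
  proof (cases "c \<in> A \<and> \<gamma> (s t) \<in> chart_dom c")
    case True
    obtain I' where "open I' \<and> s t \<in> I' \<and>
      (\<forall>r\<in>I'. (\<lambda>r. coord c (\<gamma> r)) differentiable (at r)) \<and>
      (\<lambda>r. vector_derivative (\<lambda>q. coord c (\<gamma> q)) (at r)) differentiable (at (s t))"
      using \<gamma>[OF conjunct1[OF True] conjunct2[OF True]] ..
    then have I': "open I'" "s t \<in> I'"
      "\<And>r. r \<in> I' \<Longrightarrow> (\<lambda>r. coord c (\<gamma> r)) differentiable (at r)"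
      "(\<lambda>r. vector_derivative (\<lambda>q. coord c (\<gamma> q)) (at r)) differentiable (at (s t))"
      by auto
    have "continuous_on J s"
      using sd by (simp add: continuous_at_imp_continuous_on differentiable_imp_continuous_within)
    then have "open (J \<inter> s -` I')"
      using continuous_on_open_vimage[OF J(1), of s] I'(1) by (simp add: Int_commute)
    then have acc: "vector_derivative (\<lambda>r. vector_derivative (\<lambda>q. coord c (\<gamma> (s q))) (at r)) (at t) =
        ?s'\<^sup>2 *\<^sub>R vector_derivative (\<lambda>r. vector_derivative (\<lambda>q. coord c (\<gamma> q)) (at r)) (at (s t)) +
        vector_derivative (\<lambda>r. vector_derivative s (at r)) (at t) *\<^sub>R
          vector_derivative (\<lambda>q. coord c (\<gamma> q)) (at (s t))"
      by (rule vector_derivative_twice_compose)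
        (use I' J sd smooth_on_vector_derivative[OF s J] in auto)
    have vel: "velocity A (\<lambda>r. \<gamma> (s r)) t c = ?s' *\<^sub>R velocity A \<gamma> (s t) c"
      using vector_derivative_at[OF vector_derivative_compose[OF sd[OF J(2)] I'(3)[OF I'(2)]]] True
      by (simp add: velocity_def)
    have "bilinear (\<Gamma> c (\<gamma> (s t)))"
      using \<Gamma> True unfolding affine_connection_def by blast
    then have "\<Gamma> c (\<gamma> (s t)) (?s' *\<^sub>R x) (?s' *\<^sub>R x) = ?s'\<^sup>2 *\<^sub>R \<Gamma> c (\<gamma> (s t)) x x" for x
      by (simp add: bilinear_lmul bilinear_rmul power2_eq_square)
    with True acc vel show ?thesis
      by (simp add: acceleration_def velocity_def[of A \<gamma>] scaleR_add_right)
  qed (auto simp: acceleration_def velocity_def)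
qed

text \<open>Bilinearity is available only through \<open>metric_in\<close>, so the vector and its
  multiple are first shown to be tangent and then written by their components in a chart.\<close>

lemma riemannian_metric_scale:
  assumes A: "smooth_structure A" "riemannian_metric A g" and X: "X \<in> tangent_space A p"
  shows "g p (\<lambda>c. a *\<^sub>R X c) (\<lambda>c. a *\<^sub>R X c) = a\<^sup>2 * g p X X"
proof -
  let ?c = "chart_at A p"
  have c: "?c \<in> A" "p \<in> chart_dom ?c"
    using smooth_structure_chart_at[OF A(1)] by auto
  have aX: "(\<lambda>c. a *\<^sub>R X c) \<in> tangent_space A p"
  proof (rule tangent_spaceI)
    fix c d assume cd: "c \<in> A" "d \<in> A" "p \<in> chart_dom c" "p \<in> chart_dom d"
    show "a *\<^sub>R X d = jac c d p (a *\<^sub>R X c)"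
      using linear_scale[OF linear_jac[OF A(1) cd]] tangent_space_jac[OF X cd] by simp
  next
    fix c assume "\<not> (c \<in> A \<and> p \<in> chart_dom c)"
    with X have "X c = 0" unfolding tangent_space_def by blast
    then show "a *\<^sub>R X c = 0" by simp
  qed
  have g: "g p Y Y = metric_in A g ?c p (Y ?c) (Y ?c)" if "Y \<in> tangent_space A p" for Y
    using tangent_of_eq[OF A(1) c that] by (simp add: metric_in_def)
  have "bilinear (metric_in A g ?c p)"
    using A(2) c unfolding riemannian_metric_def by blast
  then show ?thesis
    unfolding g[OF X] g[OF aX] by (simp add: bilinear_lmul bilinear_rmul power2_eq_square)
qed

text \<open>\<open>P\<close> and \<open>Q\<close> are the frame determinants of \<open>(\<gamma>', \<eta>)\<close> in two charts with Jacobian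
  determinant \<open>D\<close>; \<open>s\<close>, \<open>a\<close> and \<open>k\<close> are the factors by which \<open>\<gamma>'\<close>, \<open>\<eta>\<close> and \<open>\<nu>\<close> change.\<close>

lemma sign_changes_cancel:
  fixes s a k D P Q x v w :: real
  assumes "s * a * P = D * Q" "P > 0" "Q > 0" "a \<noteq> 0" "s \<noteq> 0" "k = 1 \<or> k = -1"
  shows "sgn (k * (D * (a * x))) * (s ^ 3 * k * v / sqrt (s\<^sup>2 * w) ^ 3) = sgn x * (v / sqrt w ^ 3)"
proof -
  have "sgn (s * a * P) = sgn (D * Q)" using assms(1) by simp
  then have D: "sgn D = sgn s * sgn a" using assms(2,3) by (simp add: sgn_mult)
  have "s ^ 3 / \<bar>s\<bar> ^ 3 = sgn s"
    using assms(5) by (simp add: sgn_if power3_eq_cube)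
  moreover have "sqrt (s\<^sup>2 * w) ^ 3 = \<bar>s\<bar> ^ 3 * sqrt w ^ 3"
    by (simp add: real_sqrt_mult power_mult_distrib)
  \<comment> \<open>This covers \<open>w = 0\<close> as well, where both quotients are 0 because
    division by zero yields 0.\<close>
  moreover have "s ^ 3 * k * v / (\<bar>s\<bar> ^ 3 * sqrt w ^ 3) = s ^ 3 / \<bar>s\<bar> ^ 3 * k * (v / sqrt w ^ 3)"
    by simp
  ultimately have v: "s ^ 3 * k * v / sqrt (s\<^sup>2 * w) ^ 3 = sgn s * k * (v / sqrt w ^ 3)"
    by simp
  have "sgn k * k = 1" "sgn s * sgn s = 1" "sgn a * sgn a = 1"
    using assms by (auto simp: sgn_if)
  moreover have "sgn (k * (D * (a * x))) * (sgn s * k * (v / sqrt w ^ 3)) =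
      (sgn k * k) * (sgn s * sgn s) * (sgn a * sgn a) * (sgn x * (v / sqrt w ^ 3))"
    unfolding sgn_mult D by (simp only: ac_simps)
  ultimately show ?thesis
    unfolding v by simp
qed

theorem theorem1p6:
  fixes AM OM OM' :: "('m::{t2_space, second_countable_topology}, 2) chart set"
    and AN ON :: "('n::{t2_space, second_countable_topology}, 3) chart set"
    and g :: "'n \<Rightarrow> ('n, 3) tvec \<Rightarrow> ('n, 3) tvec \<Rightarrow> real"
    and \<Gamma> :: "('n, 3) conn"
    and f :: "'m \<Rightarrow> 'n"
    and \<nu> \<nu>' :: "'m \<Rightarrow> ('n, 3) tvec"
    and \<gamma> :: "real \<Rightarrow> 'm"
    and \<eta> \<eta>' :: "real \<Rightarrow> ('m, 2) tvec"
    and c c' :: "('m, 2) chart"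
    and s :: "real \<Rightarrow> real"
    and I J :: "real set"
    and t :: real
  assumes M: "smooth_structure AM" "orientation AM OM"
    and N: "smooth_structure AN" "orientation AN ON" "riemannian_metric AN g" "levi_civita AN g \<Gamma>"
    and f: "front AM AN g f \<nu>"
    and \<gamma>: "open I" "is_interval I" "cuspidal_edge_curve AM AN f I \<gamma>"
    and \<eta>: "null_field AM OM AN f I \<gamma> \<eta>"
    \<comment> \<open>another parameter, of the same or the opposite orientation\<close>
    and s: "open J" "is_interval J" "reparametrization J I s"
    \<comment> \<open>another orientation of \<open>M\<close>, unit normal field and null field\<close>
    and OM': "orientation AM OM'"
    and \<nu>': "\<nu>' = \<nu> \<or> \<nu>' = (\<lambda>p d. - \<nu> p d)"
    and \<eta>': "null_field AM OM' AN f J (\<gamma> \<circ> s) \<eta>'"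
    and t: "t \<in> J"
    and c: "c \<in> OM" "\<gamma> (s t) \<in> chart_dom c"
    and c': "c' \<in> OM'" "\<gamma> (s t) \<in> chart_dom c'"
  shows "singular_curvature AM AN ON g \<Gamma> f \<nu>' c' (\<gamma> \<circ> s) \<eta>' t
       = singular_curvature AM AN ON g \<Gamma> f \<nu> c \<gamma> \<eta> (s t)"
proof -
  let ?p = "\<gamma> (s t)"
  let ?s' = "vector_derivative s (at t)"
  let ?J = "jac c' c ?p"
  let ?D = "det (matrix ?J)"
  have fm: "smooth_map AM AN f" and \<nu>: "unit_normal_field AM AN g f \<nu>"
    using f unfolding front_def by auto
  have cA: "c \<in> AM" "c' \<in> AM"
    using c(1) c'(1) M(2) OM' unfolding orientation_def by auto
  have sc: "smooth_curve AM I \<gamma>" using \<gamma>(3) unfolding cuspidal_edge_curve_def by blast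
  have ss: "smooth_on J s" and st: "s t \<in> I"
    using s(3) t unfolding reparametrization_def bij_betw_def by auto
  have sd: "s differentiable (at t)"
    using smooth_on_differentiable[OF ss t] .
  \<comment> \<open>The factor \<open>k\<close> treats both choices of the normal at once.\<close>
  obtain k :: real where k: "k = 1 \<or> k = -1" "\<nu>' = (\<lambda>p d. k *\<^sub>R \<nu> p d)"
    using \<nu>' by (metis scaleR_one scaleR_minus1_left)

  have \<gamma>d: "(\<lambda>r. coord e (\<gamma> r)) differentiable (at (s t))" if "e \<in> AM" "?p \<in> chart_dom e" for e
    using smooth_on_differentiable[of "I \<inter> \<gamma> -` chart_dom e" "\<lambda>r. coord e (\<gamma> r)" "s t"] sc st that
    unfolding smooth_curve_def by blast
  have "continuous_on I \<gamma>" using sc unfolding smooth_curve_def by blast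
  then have V: "velocity AM \<gamma> (s t) \<in> tangent_space AM ?p"
    using velocity_in_tangent_space[OF M(1) \<gamma>(1) st _ \<gamma>d] by blast
  have V': "velocity AM (\<gamma> \<circ> s) t = (\<lambda>e. ?s' *\<^sub>R velocity AM \<gamma> (s t) e)"
    using velocity_reparametrize[OF sd \<gamma>d] by (simp add: o_def)

  \<comment> \<open>Comparison of the two null fields\<close>
  have ker: "{X \<in> tangent_space AM ?p. pushforward AM AN f ?p X = (\<lambda>_. 0)} =
      {(\<lambda>e. a *\<^sub>R \<eta> (s t) e) |a. True}" and fr: "pos_frame OM ?p (velocity AM \<gamma> (s t)) (\<eta> (s t))"
    using \<eta> st unfolding null_field_def by auto
  have ker': "{X \<in> tangent_space AM ?p. pushforward AM AN f ?p X = (\<lambda>_. 0)} =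
      {(\<lambda>e. a *\<^sub>R \<eta>' t e) |a. True}" and fr': "pos_frame OM' ?p (velocity AM (\<gamma> \<circ> s) t) (\<eta>' t)"
    using \<eta>' t unfolding null_field_def by auto
  \<comment> \<open>Each null vector lies in its own span, hence in the kernel; as both spans equal
    the same kernel, \<open>\<eta>'\<close> is a multiple of \<open>\<eta>\<close>.\<close>
  have "\<eta> (s t) \<in> {(\<lambda>e. a *\<^sub>R \<eta> (s t) e) |a. True}" "\<eta>' t \<in> {(\<lambda>e. a *\<^sub>R \<eta>' t e) |a. True}"
    by (auto intro: exI[of _ 1])
  then have \<eta>0: "\<eta> (s t) \<in> tangent_space AM ?p" "pushforward AM AN f ?p (\<eta> (s t)) = (\<lambda>_. 0)"
    and \<eta>'0: "\<eta>' t \<in> tangent_space AM ?p" "\<eta>' t \<in> {(\<lambda>e. a *\<^sub>R \<eta> (s t) e) |a. True}"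
    using ker ker' by auto
  then obtain a where a: "\<eta>' t = (\<lambda>e. a *\<^sub>R \<eta> (s t) e)" by blast

  \<comment> \<open>The sign of the Jacobian determinant\<close>
  let ?P = "det (vector [velocity AM \<gamma> (s t) c, \<eta> (s t) c] :: real ^ 2 ^ 2)"
  let ?Q = "det (vector [velocity AM (\<gamma> \<circ> s) t c', \<eta>' t c'] :: real ^ 2 ^ 2)"
  have P: "?P > 0" and Q: "?Q > 0"
    using fr fr' c c' unfolding pos_frame_def by auto
  have jac: "X c = ?J (X c')" if "X \<in> tangent_space AM ?p" for X
    using tangent_space_jac[OF that cA(2,1) c'(2) c(2)] .
  have lin: "linear ?J"
    by (rule linear_jac[OF M(1) cA(2,1) c'(2) c(2)])
  have "?s' *\<^sub>R velocity AM \<gamma> (s t) c = ?J (velocity AM (\<gamma> \<circ> s) t c')"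
    unfolding V' using jac[OF V] linear_scale[OF lin] by simp
  moreover have J\<eta>: "?J (\<eta>' t c') = a *\<^sub>R \<eta> (s t) c"
    unfolding a using jac[OF \<eta>0(1)] linear_scale[OF lin] by simp
  \<comment> \<open>\<open>?J\<close> carries the new frame in the chart \<open>c'\<close> to the
    multiples by \<open>?s'\<close> and \<open>a\<close> of the old frame in \<open>c\<close>;
    comparing determinants ties the sign of \<open>?D\<close> to that of
    \<open>?s' * a\<close>.\<close>
  ultimately have "?D * ?Q = det (vector [?s' *\<^sub>R velocity AM \<gamma> (s t) c, a *\<^sub>R \<eta> (s t) c] :: real ^ 2 ^ 2)"
    using det_linear_vector_2[OF lin] by metis
  then have sign: "?s' * a * ?P = ?D * ?Q"
    unfolding det_vector_2 by (simp add: algebra_simps)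
  \<comment> \<open>Both numbers are factors of the positive frame determinant
    \<open>?Q\<close>.\<close>
  have nz: "a \<noteq> 0" "?s' \<noteq> 0"
    using Q unfolding det_vector_2 a V' by auto
  have \<eta>c: "\<eta> (s t) c \<noteq> 0"
    using P unfolding det_vector_2 by auto

  \<comment> \<open>The differential of the area density\<close>
  let ?dL = "frechet_derivative (\<lambda>z. area_density AM AN ON g f \<nu> c (param c z)) (at (coord c ?p))"
  have "area_density AM AN ON g f \<nu> c ?p = 0"
    by (rule area_density_eq_0[OF M(1) N(1,2) fm cA(1) c(2) \<eta>0(1) \<eta>c \<eta>0(2)])
  from has_derivative_mult_right[OF area_density_derivative_change_chart
      [OF M(1) N(1-3) fm \<nu> cA(1) c(2) cA(2) c'(2) this], of k]
  have "((\<lambda>z. area_density AM AN ON g f \<nu>' c' (param c' z)) has_derivative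
      (\<lambda>x. k * (?D * ?dL (?J x)))) (at (coord c' ?p))"
    unfolding k(2) area_density_scale_normal .
  then have dL': "frechet_derivative (\<lambda>z. area_density AM AN ON g f \<nu>' c' (param c' z)) (at (coord c' ?p)) =
      (\<lambda>x. k * (?D * ?dL (?J x)))"
    by (rule frechet_derivative_at[symmetric])
  have "linear ?dL"
    using area_density_differentiable[OF M(1) N(1-3) fm \<nu> cA(1) c(2)]
    by (rule linear_frechet_derivative)
  then have dL\<eta>: "?dL (a *\<^sub>R \<eta> (s t) c) = a * ?dL (\<eta> (s t) c)"
    by (simp add: linear_scale)

  \<comment> \<open>Velocity and acceleration of the image curve\<close>
  let ?h = "\<lambda>r. f (\<gamma> r)"
  let ?s'' = "vector_derivative (\<lambda>r. vector_derivative s (at r)) (at t)"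
  have h: "\<exists>I'. open I' \<and> s t \<in> I' \<and>
      (\<forall>r\<in>I'. (\<lambda>r. coord d (f (\<gamma> r))) differentiable (at r)) \<and>
      (\<lambda>r. vector_derivative (\<lambda>q. coord d (f (\<gamma> q))) (at r)) differentiable (at (s t))"
    if d: "d \<in> AN" "f ?p \<in> chart_dom d" for d
    using smooth_map_curve[OF M(1) N(1) fm sc \<gamma>(1) st d] by metis
  have hd: "(\<lambda>r. coord d (f (\<gamma> r))) differentiable (at (s t))"
    if "d \<in> AN" "f ?p \<in> chart_dom d" for d
    using h[OF that] by blast
  have "continuous_on I ?h"
    using continuous_on_compose[of I \<gamma> f] sc fm unfolding smooth_curve_def smooth_map_def
    by (auto simp: o_def intro: continuous_on_subset)
  then have Vh: "velocity AN ?h (s t) \<in> tangent_space AN (f ?p)"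
    using velocity_in_tangent_space[OF N(1) \<gamma>(1) st _ hd] by blast
  have Vh': "velocity AN (\<lambda>r. f (\<gamma> (s r))) t = (\<lambda>d. ?s' *\<^sub>R velocity AN ?h (s t) d)"
    by (rule velocity_reparametrize[OF sd hd])
  have "affine_connection AN \<Gamma>"
    using N(4) unfolding levi_civita_def by blast
  then have Ah': "acceleration AN \<Gamma> (\<lambda>r. f (\<gamma> (s r))) t = (\<lambda>d.
      ?s'\<^sup>2 *\<^sub>R acceleration AN \<Gamma> ?h (s t) d + ?s'' *\<^sub>R velocity AN ?h (s t) d)"
    by (rule acceleration_reparametrize[OF _ s(1) t ss h])
  \<comment> \<open>The substitutions leave the identity of \<open>sign_changes_cancel\<close>, in
    which \<open>x\<close> is the differential of the area density at the null vector,
    \<open>v\<close> the volume and \<open>w\<close> the squared speed of the image curve, all for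
    the original data.\<close>
  show ?thesis
    unfolding singular_curvature_def Let_def o_def dL' J\<eta> dL\<eta>
    unfolding Vh' Ah' riemannian_metric_scale[OF N(1,3) Vh] k(2) volume_form_change_frame
    by (rule sign_changes_cancel[OF sign P Q nz k(1)])
qed

end
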